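(* Let $-\infty<a<b<\infty$, let $p=1$ on $(a,b)$, and let $q,w\in L^1(a,b)$ be real-valued with $w\neq 0$ a.e. on $(a,b)$, such that both $\{x\in(a,b):w(x)>0\}$ and $\{x\in(a,b):w(x)<0\}$ have positive Lebesgue measure. Assume that $w$ has $n$ turning points in $(a,b)$. Let $\mathcal{D}$ be a selfadjoint domain, let $c(\mathcal{D})$ be the associated constant, and set (with $\|p^{-1}\|_1=b-a$) $$\alpha:=c(\mathcal{D})+\|q_-\|_1,\qquad \beta:=\sqrt{\alpha\bigl(1/\|p^{-1}\|_1+\alpha\bigr)}+\alpha,\qquad \gamma:=\sqrt{2\beta+1/\|p^{-1}\|_1},$$ where $q_-(x):=\min\{0,q(x)\}$. Let $\varepsilon>0$ be such that $$\mu_1\bigl(\{x\in(a,b):|w(x)|<\varepsilon\}\bigr)\le\frac{1}{4\gamma^2},$$ where $\mu_1$ is Lebesgue measure. Then every eigenvalue $\lambda\in\mathbb{C}\setminus\mathbb{R}$ of the operator $A(\mathcal{D})$ satisfies $$|\operatorname{Im}\lambda|\le\frac{8}{\varepsilon}\,\beta\,\gamma^2\,(n+1)\qquad\text{and}\qquad|\operatorname{Re}\lambda|\le\frac{2}{\varepsilon}\bigl(4\,\beta\,\gamma^2\,(n+1)+(\beta^2+\gamma^2\|q\|_1)\bigr).$$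
   Context: Turning points: $w$ has $n$ turning points $x_1<\dots<x_n$ in $(a,b)$ if, with $x_0:=a$ and $x_{n+1}:=b$, $\operatorname{sgn}(w)$ is (a.e.) constant on each of the intervals $(x_k,x_{k+1})$, $k=0,\dots,n$, and changes from each of these intervals to the next. Notation: $\|\cdot\|_1$ is the $L^1$-norm on $(a,b)$. $L^2_{|w|}(a,b)$ is the $L^2$-space on $(a,b)$ with respect to the measure $|w|\,dt$. Differential expression (here with $p=1$): $\tau(f)=\frac1w\bigl(-f''+qf\bigr)$. The maximal domain $\mathcal{D}_{\max}$ is the set of all $f:(a,b)\to\mathbb{C}$ in $L^2_{|w|}(a,b)$ such that $f$ and $f'$ are absolutely continuous on $[a,b]$ and $\tau(f)\in L^2_{|w|}(a,b)$. A selfadjoint domain is a set $\mathcal{D}$ of one of the following two forms: (separated) $\mathcal{D}_{\rm sep}(l,r)=\{f\in\mathcal{D}_{\max}:f'(a)=lf(a),\ f'(b)=rf(b)\}$ with $l,r\in\mathbb{R}\cup\{\infty\}$, where $l=\infty$ (resp. $r=\infty$) means the Dirichlet condition $f(a)=0$ (resp. $f(b)=0$); (coupled) $\mathcal{D}_{\rm coup}(\varphi,R)=\left\{f\in\mathcal{D}_{\max}:\begin{pmatrix} f(b) \\ f'(b) \end{pmatrix}=e^{i\varphi}R\begin{pmatrix} f(a) \\ f'(a) \end{pmatrix}\right\}$ with $\varphi\in[0,2\pi)$ and $R=(r_{ij})_{i,j=1}^2\in\mathbb{R}^{2\times2}$, $\det R=1$. The constant $c(\mathcal{D})\ge0$ is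 defined by: $c(\mathcal{D})=|l|+|r|$ if $\mathcal{D}=\mathcal{D}_{\rm sep}(l,r)$ with $l,r\in\mathbb{R}$; $c(\mathcal{D})=|r|$ if $\mathcal{D}=\mathcal{D}_{\rm sep}(\infty,r)$ with $r\in\mathbb{R}$; $c(\mathcal{D})=|l|$ if $\mathcal{D}=\mathcal{D}_{\rm sep}(l,\infty)$ with $l\in\mathbb{R}$; $c(\mathcal{D})=0$ if $\mathcal{D}=\mathcal{D}_{\rm sep}(\infty,\infty)$; $c(\mathcal{D})=\frac{|r_{11}|+|r_{22}|+2}{|r_{12}|}$ if $\mathcal{D}=\mathcal{D}_{\rm coup}(\varphi,R)$ and $r_{12}\ne0$; $c(\mathcal{D})=|r_{11}r_{21}|$ if $\mathcal{D}=\mathcal{D}_{\rm coup}(\varphi,R)$ and $r_{12}=0$. The operator $A(\mathcal{D})$ in $L^2_{|w|}(a,b)$ is $A(\mathcal{D})f=\tau(f)$ with $\operatorname{dom}A(\mathcal{D})=\mathcal{D}$. Thus $\lambda$ is an eigenvalue of $A(\mathcal{D})$ iff there is $\phi\in\mathcal{D}$, $\phi\neq0$, with $-\phi''+q\phi=\lambda w\phi$ a.e. on $(a,b)$. *)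

theory Defs
  imports "HOL-Analysis.Analysis"
begin

text \<open>
  Functions on \<open>(a,b)\<close> or \<open>[a,b]\<close> are total functions on the reals; nothing below
  depends on their values outside \<open>[a,b]\<close>.
\<close>

text \<open>
  The members of \<open>P\<close> are the endpoint pairs of non-overlapping subintervals. A pair with
  \<open>u = v\<close> contributes nothing to either sum.
\<close>

definition absolutely_continuous_on_interval :: "real \<Rightarrow> real \<Rightarrow> (real \<Rightarrow> complex) \<Rightarrow> bool" where
  "absolutely_continuous_on_interval a b f \<longleftrightarrow>
     (\<forall>e>0. \<exists>d>0. \<forall>P :: (real \<times> real) set.
        finite P \<longrightarrow> (\<forall>(u, v)\<in>P. a \<le> u \<and> u \<le> v \<and> v \<le> b) \<longrightarrow>
        disjoint_family_on (\<lambda>(u, v). {u<..<v}) P \<longrightarrow>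
        (\<Sum>(u, v)\<in>P. v - u) < d \<longrightarrow>
        (\<Sum>(u, v)\<in>P. norm (f v - f u)) < e)"

text \<open>One-sided at the endpoints; an unspecified value where \<open>f\<close> is not differentiable.\<close>

definition deriv_within :: "real \<Rightarrow> real \<Rightarrow> (real \<Rightarrow> complex) \<Rightarrow> real \<Rightarrow> complex" where
  "deriv_within a b f x = vector_derivative f (at x within {a..b})"

definition L1_norm :: "real \<Rightarrow> real \<Rightarrow> (real \<Rightarrow> real) \<Rightarrow> real" where
  "L1_norm a b f = (LINT x|lebesgue_on {a<..<b}. \<bar>f x\<bar>)"

definition weighted_measure :: "real \<Rightarrow> real \<Rightarrow> (real \<Rightarrow> real) \<Rightarrow> real measure" where
  "weighted_measure a b w = density (lebesgue_on {a<..<b}) (\<lambda>x. ennreal \<bar>w x\<bar>)"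

definition L2_weighted :: "real \<Rightarrow> real \<Rightarrow> (real \<Rightarrow> real) \<Rightarrow> (real \<Rightarrow> complex) set" where
  "L2_weighted a b w =
     {f. f \<in> borel_measurable (weighted_measure a b w) \<and>
         integrable (weighted_measure a b w) (\<lambda>x. (norm (f x))\<^sup>2)}"

definition has_turning_points :: "real \<Rightarrow> real \<Rightarrow> (real \<Rightarrow> real) \<Rightarrow> nat \<Rightarrow> bool" where
  "has_turning_points a b w n \<longleftrightarrow>
     (\<exists>(x :: nat \<Rightarrow> real) (s :: nat \<Rightarrow> real).
        x 0 = a \<and> x (n + 1) = b \<and> (\<forall>k\<le>n. x k < x (k + 1)) \<and>
        (\<forall>k\<le>n. AE t in lebesgue_on {x k<..<x (k + 1)}. sgn (w t) = s k) \<and>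
        (\<forall>k<n. s (k + 1) \<noteq> s k))"

definition tau :: "real \<Rightarrow> real \<Rightarrow> (real \<Rightarrow> real) \<Rightarrow> (real \<Rightarrow> real) \<Rightarrow>
    (real \<Rightarrow> complex) \<Rightarrow> real \<Rightarrow> complex" where
  "tau a b q w f x =
     1 / of_real (w x) * (- deriv_within a b (deriv_within a b f) x + of_real (q x) * f x)"

text \<open>
  Since \<open>f\<close> and its (almost everywhere) derivative are both absolutely continuous, \<open>f\<close> is
  continuously differentiable on \<open>[a,b]\<close>; so the derivative is required at every point of \<open>[a,b]\<close>.
  The second derivative in \<open>tau\<close> exists almost everywhere only.
\<close>

definition maximal_domain :: "real \<Rightarrow> real \<Rightarrow> (real \<Rightarrow> real) \<Rightarrow> (real \<Rightarrow> real) \<Rightarrow>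
    (real \<Rightarrow> complex) set" where
  "maximal_domain a b q w =
     {f. f \<in> L2_weighted a b w \<and>
         absolutely_continuous_on_interval a b f \<and>
         (\<forall>x\<in>{a..b}. f differentiable (at x within {a..b})) \<and>
         absolutely_continuous_on_interval a b (deriv_within a b f) \<and>
         tau a b q w f \<in> L2_weighted a b w}"

text \<open>The parameters in \<open>\<real> \<union> {\<infinity>}\<close> of the separated conditions.\<close>

datatype endpoint_parameter = Finite real | Infinite

datatype boundary_condition =
    Separated endpoint_parameter endpoint_parameter
  | Coupled real "real^2^2"

fun admissible_condition :: "boundary_condition \<Rightarrow> bool" where
  "admissible_condition (Separated l r) \<longleftrightarrow> True"
| "admissible_condition (Coupled \<phi> R) \<longleftrightarrow> 0 \<le> \<phi> \<and> \<phi> < 2 * pi \<and> det R = 1"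

fun endpoint_condition :: "endpoint_parameter \<Rightarrow> complex \<Rightarrow> complex \<Rightarrow> bool" where
  "endpoint_condition (Finite l) y y' \<longleftrightarrow> y' = of_real l * y"
| "endpoint_condition Infinite y y' \<longleftrightarrow> y = 0"

fun selfadjoint_domain :: "real \<Rightarrow> real \<Rightarrow> (real \<Rightarrow> real) \<Rightarrow> (real \<Rightarrow> real) \<Rightarrow>
    boundary_condition \<Rightarrow> (real \<Rightarrow> complex) set" where
  "selfadjoint_domain a b q w (Separated l r) =
     {f \<in> maximal_domain a b q w.
        endpoint_condition l (f a) (deriv_within a b f a) \<and>
        endpoint_condition r (f b) (deriv_within a b f b)}"
| "selfadjoint_domain a b q w (Coupled \<phi> R) =
     {f \<in> maximal_domain a b q w.
        f b = exp (\<i> * of_real \<phi>) *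
                (of_real (R$1$1) * f a + of_real (R$1$2) * deriv_within a b f a) \<and>
        deriv_within a b f b = exp (\<i> * of_real \<phi>) *
                (of_real (R$2$1) * f a + of_real (R$2$2) * deriv_within a b f a)}"

text \<open>
  The constant depends only on the domain: the parameters of a domain are unique up to
  replacing \<open>(\<phi>, R)\<close> by \<open>(\<phi> \<plusminus> \<pi>, -R)\<close>.
\<close>

fun domain_constant :: "boundary_condition \<Rightarrow> real" where
  "domain_constant (Separated (Finite l) (Finite r)) = \<bar>l\<bar> + \<bar>r\<bar>"
| "domain_constant (Separated Infinite (Finite r)) = \<bar>r\<bar>"
| "domain_constant (Separated (Finite l) Infinite) = \<bar>l\<bar>"
| "domain_constant (Separated Infinite Infinite) = 0"
| "domain_constant (Coupled \<phi> R) =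
     (if R$1$2 \<noteq> 0 then (\<bar>R$1$1\<bar> + \<bar>R$2$2\<bar> + 2) / \<bar>R$1$2\<bar>
      else \<bar>R$1$1 * R$2$1\<bar>)"

text \<open>
  The operator with domain \<open>D\<close> acts as \<open>tau\<close>; both the eigenvalue equation and
  nontriviality are understood in the weighted space, that is, modulo null functions.
\<close>

definition is_eigenvalue :: "real \<Rightarrow> real \<Rightarrow> (real \<Rightarrow> real) \<Rightarrow> (real \<Rightarrow> real) \<Rightarrow>
    (real \<Rightarrow> complex) set \<Rightarrow> complex \<Rightarrow> bool" where
  "is_eigenvalue a b q w D z \<longleftrightarrow>
     (\<exists>f\<in>D. \<not> (AE x in weighted_measure a b w. f x = 0) \<and>
            (AE x in weighted_measure a b w. tau a b q w f x = z * f x))"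

end

theory Submission
  imports Defs
begin

text \<open>
  Let \<open>\<phi>\<close> be an eigenfunction and write \<open>N = \<parallel>\<phi>\<parallel>\<^sup>2\<close>, \<open>P = \<parallel>\<phi>'\<parallel>\<^sup>2\<close>, \<open>S = max \<bar>\<phi>\<bar>\<^sup>2\<close>. Testing the equation with
  \<open>\<phi>\<close> itself gives a real boundary term, so for nonreal \<open>z\<close> the integral of \<open>w\<bar>\<phi>\<bar>\<^sup>2\<close> vanishes and
  \<open>P \<le> \<alpha> S\<close>. Together with \<open>S \<le> N / (b - a) + 2 sqrt (N P)\<close> this yields \<open>P \<le> \<beta>\<^sup>2 N\<close> and \<open>S \<le> \<gamma>\<^sup>2 N\<close>.
  Now test with \<open>g \<phi>\<close>, where \<open>g\<close> agrees with \<open>sgn w\<close> except for linear ramps of width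
  \<open>\<delta> = 1 / (4 \<gamma>\<^sup>2 (n + 1))\<close> down to \<open>0\<close> on both sides of every turning point and at \<open>a\<close> and \<open>b\<close>: there is
  no boundary term, \<open>\<bar>g'\<bar> \<le> 1 / \<delta>\<close>, and the integral of \<open>g w \<bar>\<phi>\<bar>\<^sup>2\<close> is at least \<open>\<epsilon> N / 2\<close> because the
  ramps and the set where \<open>\<bar>w\<bar> < \<epsilon>\<close> each lose at most a quarter of \<open>N\<close>. Integration by parts rests on
  the fundamental theorem of calculus for absolutely continuous functions, which is obtained from the
  Jordan decomposition, the Radon-Nikodym theorem for the Stieltjes measure of a monotone function, and
  almost everywhere differentiability of indefinite integrals.
\<close>

text \<open>For nonreal \<open>z\<close>, testing with the eigenfunction itself says nothing about
  the size of \<open>z\<close>: the imaginary part only makes the integral of \<open>w\<close> times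
  |f|^2 vanish, and \<open>z\<close> drops out of the real part. The factor \<open>sgn w\<close>
  would replace \<open>w\<close> by |w|, but it jumps; the ramps buy differentiability, and their
  slope is what brings \<gamma>^2 (n + 1) into the bounds. Letting the cut-off vanish at
  \<open>a\<close> and \<open>b\<close> as well confines the boundary condition to the a priori
  estimates.

  Origin of the constants, with L = 1 / (b - a) and t = sqrt (P / N): combining the bounds for P and
  S gives t^2 \<le> \<alpha> (L + 2 t), and \<beta> is the larger root. Inserting t \<le> \<beta>
  into the bound for S gives (2 \<beta> + L) N = \<gamma>^2 N. Each of the n + 1 intervals loses at
  most \<delta> / 2 at either end, so all ramps together lose (n + 1) \<delta> = 1 / (4 \<gamma>^2),
  the very measure allowed for the set where |w| < \<epsilon>. The term with g' is at most \<beta> N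
  / \<delta>; division by \<epsilon> N / 2 gives the 8 in the bound for the imaginary part.\<close>

section \<open>Absolute continuity\<close>

text \<open>
  Families of intervals indexed by an arbitrary finite set, instead of sets of endpoint pairs, survive
  clipping and reindexing even when some of the clipped intervals coincide.
\<close>

definition ac_on :: "real \<Rightarrow> real \<Rightarrow> (real \<Rightarrow> 'a::real_normed_vector) \<Rightarrow> bool" where
  "ac_on a b f \<longleftrightarrow>
     (\<forall>e>0. \<exists>d>0. \<forall>(I :: nat set) u v.
        finite I \<longrightarrow> (\<forall>i\<in>I. a \<le> u i \<and> u i \<le> v i \<and> v i \<le> b) \<longrightarrow>
        disjoint_family_on (\<lambda>i. {u i<..<v i}) I \<longrightarrow>
        (\<Sum>i\<in>I. v i - u i) < d \<longrightarrow> (\<Sum>i\<in>I. norm (f (v i) - f (u i))) < e)"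

text \<open>Degenerate intervals contribute nothing and are dropped. The remaining ones are
  nonempty, so disjointness makes the map from indices to endpoint pairs injective, and sums over
  indices become sums over a set of pairs.\<close>

lemma ac_on_absolutely_continuous_on_interval:
  assumes "absolutely_continuous_on_interval a b f"
  shows "ac_on a b f"
  unfolding ac_on_def
proof (intro allI impI)
  fix e :: real assume "e > 0"
  with assms obtain d where d: "d > 0"
    and *: "\<And>P :: (real \<times> real) set. finite P \<Longrightarrow> (\<forall>(u, v)\<in>P. a \<le> u \<and> u \<le> v \<and> v \<le> b) \<Longrightarrow>
        disjoint_family_on (\<lambda>(u, v). {u<..<v}) P \<Longrightarrow> (\<Sum>(u, v)\<in>P. v - u) < d \<Longrightarrow>
        (\<Sum>(u, v)\<in>P. norm (f v - f u)) < e"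
    unfolding absolutely_continuous_on_interval_def by auto
  show "\<exists>d>0. \<forall>(I :: nat set) u v.
        finite I \<longrightarrow> (\<forall>i\<in>I. a \<le> u i \<and> u i \<le> v i \<and> v i \<le> b) \<longrightarrow>
        disjoint_family_on (\<lambda>i. {u i<..<v i}) I \<longrightarrow>
        (\<Sum>i\<in>I. v i - u i) < d \<longrightarrow> (\<Sum>i\<in>I. norm (f (v i) - f (u i))) < e"
  proof (intro exI[of _ d] conjI allI impI d)
    fix I :: "nat set" and u v :: "nat \<Rightarrow> real"
    assume fin: "finite I" and uv: "\<forall>i\<in>I. a \<le> u i \<and> u i \<le> v i \<and> v i \<le> b"
      and dis: "disjoint_family_on (\<lambda>i. {u i<..<v i}) I" and sm: "(\<Sum>i\<in>I. v i - u i) < d"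
    define I' where "I' = {i\<in>I. u i < v i}"
    define P where "P = (\<lambda>i. (u i, v i)) ` I'"
    have I': "finite I'" "I' \<subseteq> I" using fin by (auto simp: I'_def)
    have inj: "inj_on (\<lambda>i. (u i, v i)) I'"
    proof (rule inj_onI)
      fix i j assume ij: "i \<in> I'" "j \<in> I'" "(u i, v i) = (u j, v j)"
      show "i = j"
      proof (rule ccontr)
        assume "i \<noteq> j"
        then have "{u i<..<v i} \<inter> {u j<..<v j} = {}"
          using dis ij I' unfolding disjoint_family_on_def by blast
        then show False using ij by (auto simp: I'_def)
      qed
    qed
    have s1: "(\<Sum>i\<in>I. g (v i) (u i)) = (\<Sum>(u, v)\<in>P. g v u)" if "\<And>x. g x x = 0"
      for g :: "real \<Rightarrow> real \<Rightarrow> real"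
    proof -
      have "(\<Sum>i\<in>I. g (v i) (u i)) = (\<Sum>i\<in>I'. g (v i) (u i))"
        by (rule sum.mono_neutral_right) (use fin uv that in \<open>force simp: I'_def\<close>)+
      also have "\<dots> = (\<Sum>(u, v)\<in>P. g v u)"
        unfolding P_def by (subst sum.reindex[OF inj]) (simp add: o_def)
      finally show ?thesis .
    qed
    have "(\<Sum>(u, v)\<in>P. norm (f v - f u)) < e"
    proof (rule *)
      show "finite P" using I' by (simp add: P_def)
      show "\<forall>(u, v)\<in>P. a \<le> u \<and> u \<le> v \<and> v \<le> b" using uv I' by (auto simp: P_def)
      show "disjoint_family_on (\<lambda>(u, v). {u<..<v}) P"
        unfolding disjoint_family_on_def
      proof (intro ballI impI)
        fix p p' assume "p \<in> P" "p' \<in> P" "p \<noteq> p'"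
        then obtain i j where "p = (u i, v i)" "p' = (u j, v j)" "i \<in> I" "j \<in> I" "i \<noteq> j"
          using I' by (auto simp: P_def)
        then show "(case p of (u, v) \<Rightarrow> {u<..<v}) \<inter> (case p' of (u, v) \<Rightarrow> {u<..<v}) = {}"
          using dis unfolding disjoint_family_on_def by auto
      qed
      show "(\<Sum>(u, v)\<in>P. v - u) < d" using s1[of "\<lambda>x y. x - y"] sm by simp
    qed
    then show "(\<Sum>i\<in>I. norm (f (v i) - f (u i))) < e"
      using s1[of "\<lambda>x y. norm (f x - f y)"] by simp
  qed
qed

text \<open>An enumeration of the finite index set transfers the property from \<open>nat\<close> to
  any index type. The types \<open>unit\<close>, \<open>nat \<times> nat\<close> and
  \<open>real set\<close> occur below.\<close>

lemma ac_onD: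
  assumes "ac_on a b f" "e > 0"
  shows "\<exists>d>0. \<forall>(I :: 'i set) u v. finite I \<longrightarrow> (\<forall>i\<in>I. a \<le> u i \<and> u i \<le> v i \<and> v i \<le> b) \<longrightarrow>
        disjoint_family_on (\<lambda>i. {u i<..<v i}) I \<longrightarrow>
        (\<Sum>i\<in>I. v i - u i) < d \<longrightarrow> (\<Sum>i\<in>I. norm (f (v i) - f (u i))) < e"
proof -
  from assms have "\<exists>d>0. \<forall>(I :: nat set) u v.
        finite I \<longrightarrow> (\<forall>i\<in>I. a \<le> u i \<and> u i \<le> v i \<and> v i \<le> b) \<longrightarrow>
        disjoint_family_on (\<lambda>i. {u i<..<v i}) I \<longrightarrow>
        (\<Sum>i\<in>I. v i - u i) < d \<longrightarrow> (\<Sum>i\<in>I. norm (f (v i) - f (u i))) < e"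
    unfolding ac_on_def by simp
  then obtain d where d: "d > 0" and *: "\<forall>(I :: nat set) u v.
        finite I \<longrightarrow> (\<forall>i\<in>I. a \<le> u i \<and> u i \<le> v i \<and> v i \<le> b) \<longrightarrow>
        disjoint_family_on (\<lambda>i. {u i<..<v i}) I \<longrightarrow>
        (\<Sum>i\<in>I. v i - u i) < d \<longrightarrow> (\<Sum>i\<in>I. norm (f (v i) - f (u i))) < e"
    by (elim exE conjE)
  show ?thesis
  proof (intro exI[of _ d] conjI d allI impI)
    fix I :: "'i set" and u v :: "'i \<Rightarrow> real"
    assume fin: "finite I" and uv: "\<forall>i\<in>I. a \<le> u i \<and> u i \<le> v i \<and> v i \<le> b"
      and dis: "disjoint_family_on (\<lambda>i. {u i<..<v i}) I" and sm: "(\<Sum>i\<in>I. v i - u i) < d"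
    obtain h :: "nat \<Rightarrow> 'i" where h: "bij_betw h {0..<card I} I"
      using ex_bij_betw_nat_finite[OF fin] by blast
    have s: "(\<Sum>k\<in>{0..<card I}. g (h k)) = (\<Sum>i\<in>I. g i)" for g :: "'i \<Rightarrow> real"
      using sum.reindex_bij_betw[OF h, of g] .
    have hI: "h k \<in> I" if "k \<in> {0..<card I}" for k using bij_betwE[OF h] that by blast
    have "(\<Sum>k\<in>{0..<card I}. norm (f (v (h k)) - f (u (h k)))) < e"
    proof (rule *[rule_format])
      show "disjoint_family_on (\<lambda>i. {u (h i)<..<v (h i)}) {0..<card I}"
        unfolding disjoint_family_on_def
      proof (intro ballI impI)
        fix m n assume "m \<in> {0..<card I}" "n \<in> {0..<card I}" "m \<noteq> n"
        then have "h m \<noteq> h n" "h m \<in> I" "h n \<in> I"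
          using bij_betw_imp_inj_on[OF h] hI by (auto dest: inj_onD)
        then show "{u (h m)<..<v (h m)} \<inter> {u (h n)<..<v (h n)} = {}"
          using dis unfolding disjoint_family_on_def by blast
      qed
      show "(\<Sum>k\<in>{0..<card I}. v (h k) - u (h k)) < d"
        using sm s[of "\<lambda>i. v i - u i"] by simp
      show "a \<le> u (h k) \<and> u (h k) \<le> v (h k) \<and> v (h k) \<le> b" if "k \<in> {0..<card I}" for k
        using uv hI[OF that] by blast
    qed simp
    then show "(\<Sum>i\<in>I. norm (f (v i) - f (u i))) < e"
      using s[of "\<lambda>i. norm (f (v i) - f (u i))"] by simp
  qed
qed

lemma ac_on_pointwise:
  assumes f: "ac_on a b f" and "e > 0"
  obtains d where "d > 0"
    "\<And>x y. x \<in> {a..b} \<Longrightarrow> y \<in> {a..b} \<Longrightarrow> \<bar>y - x\<bar> < d \<Longrightarrow> norm (f y - f x) < e"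
proof -
  obtain d where d: "d > 0" and *: "\<forall>(I :: unit set) u v. finite I \<longrightarrow>
      (\<forall>i\<in>I. a \<le> u i \<and> u i \<le> v i \<and> v i \<le> b) \<longrightarrow>
        disjoint_family_on (\<lambda>i. {u i<..<v i}) I \<longrightarrow>
        (\<Sum>i\<in>I. v i - u i) < d \<longrightarrow> (\<Sum>i\<in>I. norm (f (v i) - f (u i))) < e"
    using ac_onD[where 'i = unit, OF assms] by (elim exE conjE)
  have le: "norm (f y - f x) < e" if "x \<in> {a..b}" "y \<in> {a..b}" "x \<le> y" "y - x < d" for x y
    using *[rule_format, of "{()}" "\<lambda>_. x" "\<lambda>_. y"] that by (auto simp: disjoint_family_on_def)
  show thesis
  proof (rule that[OF d])
    fix x y assume "x \<in> {a..b}" "y \<in> {a..b}" "\<bar>y - x\<bar> < d"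
    then show "norm (f y - f x) < e"
      using le[of x y] le[of y x] by (cases "x \<le> y") (auto simp: norm_minus_commute)
  qed
qed

lemma ac_on_imp_continuous_on:
  assumes "ac_on a b f"
  shows "continuous_on {a..b} f"
  unfolding continuous_on_iff dist_norm
proof (intro ballI allI impI)
  fix x e :: real assume x: "x \<in> {a..b}" "e > 0"
  show "\<exists>d>0. \<forall>x'\<in>{a..b}. norm (x' - x) < d \<longrightarrow> norm (f x' - f x) < e"
    by (rule ac_on_pointwise[OF assms x(2)]) (use x(1) in \<open>auto simp: real_norm_def\<close>)
qed

text \<open>The common source of the closure properties below: an increment bounded by those of two
  absolutely continuous functions inherits the property. Sums, differences, products, linear images
  and Lipschitz functions are all reduced to it.\<close>

lemma ac_on_dominated2:
  assumes f: "ac_on a b f" and g: "ac_on a b g" and C: "C \<ge> 0"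
    and le: "\<And>x y. a \<le> x \<Longrightarrow> x \<le> y \<Longrightarrow> y \<le> b \<Longrightarrow>
       norm (h y - h x) \<le> C * norm (f y - f x) + C * norm (g y - g x)"
  shows "ac_on a b h"
  unfolding ac_on_def
proof (intro allI impI)
  fix e :: real assume e: "e > 0"
  \<comment> \<open>\<open>C + 1\<close> in place of \<open>C\<close> keeps the divisor positive for
    \<open>C = 0\<close> and leaves room for the final strict inequality.\<close>
  define e' where "e' = e / (2 * (C + 1))"
  have e': "e' > 0" using e C by (simp add: e'_def)
  obtain d1 where d1: "d1 > 0" and D1: "\<forall>(I :: nat set) u v. finite I \<longrightarrow>
      (\<forall>i\<in>I. a \<le> u i \<and> u i \<le> v i \<and> v i \<le> b) \<longrightarrow>
        disjoint_family_on (\<lambda>i. {u i<..<v i}) I \<longrightarrow>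
        (\<Sum>i\<in>I. v i - u i) < d1 \<longrightarrow> (\<Sum>i\<in>I. norm (f (v i) - f (u i))) < e'"
    using ac_onD[where 'i = nat, OF f e'] by (elim exE conjE)
  obtain d2 where d2: "d2 > 0" and D2: "\<forall>(I :: nat set) u v. finite I \<longrightarrow>
      (\<forall>i\<in>I. a \<le> u i \<and> u i \<le> v i \<and> v i \<le> b) \<longrightarrow>
        disjoint_family_on (\<lambda>i. {u i<..<v i}) I \<longrightarrow>
        (\<Sum>i\<in>I. v i - u i) < d2 \<longrightarrow> (\<Sum>i\<in>I. norm (g (v i) - g (u i))) < e'"
    using ac_onD[where 'i = nat, OF g e'] by (elim exE conjE)
  show "\<exists>d>0. \<forall>(I :: nat set) u v.
        finite I \<longrightarrow> (\<forall>i\<in>I. a \<le> u i \<and> u i \<le> v i \<and> v i \<le> b) \<longrightarrow>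
        disjoint_family_on (\<lambda>i. {u i<..<v i}) I \<longrightarrow>
        (\<Sum>i\<in>I. v i - u i) < d \<longrightarrow> (\<Sum>i\<in>I. norm (h (v i) - h (u i))) < e"
  proof (intro exI[of _ "min d1 d2"] conjI allI impI)
    fix I :: "nat set" and u v :: "nat \<Rightarrow> real"
    assume I: "finite I" "\<forall>i\<in>I. a \<le> u i \<and> u i \<le> v i \<and> v i \<le> b"
      "disjoint_family_on (\<lambda>i. {u i<..<v i}) I" "(\<Sum>i\<in>I. v i - u i) < min d1 d2"
    have "(\<Sum>i\<in>I. norm (h (v i) - h (u i))) \<le>
        (\<Sum>i\<in>I. C * norm (f (v i) - f (u i)) + C * norm (g (v i) - g (u i)))"
      by (intro sum_mono le) (use I in auto)
    also have "\<dots> = C * (\<Sum>i\<in>I. norm (f (v i) - f (u i))) + C * (\<Sum>i\<in>I. norm (g (v i) - g (u i)))"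
      by (simp add: sum.distrib sum_distrib_left)
    also have "\<dots> \<le> C * e' + C * e'"
      using D1[rule_format, of I u v] D2[rule_format, of I u v] I C
      by (intro add_mono mult_left_mono) (auto intro: less_imp_le)
    also have "\<dots> < e"
    proof -
      have "2 * (C + 1) * e' = e" using C by (simp add: e'_def)
      then show ?thesis using e' by (simp add: algebra_simps)
    qed
    finally show "(\<Sum>i\<in>I. norm (h (v i) - h (u i))) < e" .
  qed (use d1 d2 in auto)
qed

lemma ac_on_dominated:
  assumes f: "ac_on a b f" and C: "C \<ge> 0"
    and le: "\<And>x y. a \<le> x \<Longrightarrow> x \<le> y \<Longrightarrow> y \<le> b \<Longrightarrow> norm (h y - h x) \<le> C * norm (f y - f x)"
  shows "ac_on a b h"
  by (rule ac_on_dominated2[OF f f C]) (auto intro!: order.trans[OF le] simp: C)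

lemma ac_on_lipschitz:
  assumes C: "C \<ge> 0"
    and le: "\<And>x y. a \<le> x \<Longrightarrow> x \<le> y \<Longrightarrow> y \<le> b \<Longrightarrow> norm (h y - h x) \<le> C * (y - x)"
  shows "ac_on a b h"
proof (rule ac_on_dominated[OF _ C])
  show "ac_on a b (\<lambda>x::real. x)"
    unfolding ac_on_def
  proof (intro allI impI)
    fix e :: real assume e: "e > 0"
    have "(\<Sum>i\<in>I. norm (v i - u i)) < e" if "(\<Sum>i\<in>I. v i - u i) < e"
        "\<forall>i\<in>I. a \<le> u i \<and> u i \<le> v i \<and> v i \<le> b"
      for I :: "nat set" and u v :: "nat \<Rightarrow> real"
    proof -
      have "(\<Sum>i\<in>I. norm (v i - u i)) = (\<Sum>i\<in>I. v i - u i)"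
        using that by (intro sum.cong) auto
      then show ?thesis using that by simp
    qed
    then show "\<exists>d>0. \<forall>(I :: nat set) u v.
        finite I \<longrightarrow> (\<forall>i\<in>I. a \<le> u i \<and> u i \<le> v i \<and> v i \<le> b) \<longrightarrow>
        disjoint_family_on (\<lambda>i. {u i<..<v i}) I \<longrightarrow>
        (\<Sum>i\<in>I. v i - u i) < d \<longrightarrow> (\<Sum>i\<in>I. norm (v i - u i)) < e"
      using e by blast
  qed
qed (use le in auto)

lemma ac_on_add:
  assumes "ac_on a b f" "ac_on a b g"
  shows "ac_on a b (\<lambda>x. f x + g x)"
  by (rule ac_on_dominated2[OF assms, of 1])
    (auto simp: add_diff_add norm_triangle_ineq)

lemma ac_on_diff:
  assumes "ac_on a b f" "ac_on a b g"
  shows "ac_on a b (\<lambda>x. f x - g x)"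
proof (rule ac_on_dominated2[OF assms, of 1])
  fix x y
  have "f y - g y - (f x - g x) = (f y - f x) - (g y - g x)" by simp
  then show "norm (f y - g y - (f x - g x)) \<le> 1 * norm (f y - f x) + 1 * norm (g y - g x)"
    using norm_triangle_ineq4[of "f y - f x" "g y - g x"] by (simp only: mult_1)
qed auto

lemma ac_on_bounded_linear:
  assumes "bounded_linear L" "ac_on a b f"
  shows "ac_on a b (\<lambda>x. L (f x))"
proof -
  obtain K where K: "K > 0" "\<And>x. norm (L x) \<le> norm x * K"
    using bounded_linear.pos_bounded[OF assms(1)] by auto
  show ?thesis
  proof (rule ac_on_dominated[OF assms(2), of K])
    fix x y
    show "norm (L (f y) - L (f x)) \<le> K * norm (f y - f x)"
      using K(2)[of "f y - f x"] by (simp add: linear_diff[OF bounded_linear.linear[OF assms(1)]] mult.commute)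
  qed (use K in auto)
qed

lemma ac_on_mult:
  fixes f g :: "real \<Rightarrow> 'a::real_normed_algebra"
  assumes f: "ac_on a b f" and g: "ac_on a b g"
  shows "ac_on a b (\<lambda>x. f x * g x)"
proof -
  have "bounded (f ` {a..b})" "bounded (g ` {a..b})"
    using f g by (auto intro!: compact_imp_bounded compact_continuous_image ac_on_imp_continuous_on)
  then obtain B1 B2 where "\<forall>x\<in>f ` {a..b}. norm x \<le> B1" "\<forall>x\<in>g ` {a..b}. norm x \<le> B2"
    unfolding bounded_iff by blast
  then have B: "\<And>x. x \<in> {a..b} \<Longrightarrow> norm (f x) \<le> B1" "\<And>x. x \<in> {a..b} \<Longrightarrow> norm (g x) \<le> B2"
    by auto
  define C where "C = max 0 (max B1 B2)"
  have C: "C \<ge> 0" "\<And>x. x \<in> {a..b} \<Longrightarrow> norm (f x) \<le> C" "\<And>x. x \<in> {a..b} \<Longrightarrow> norm (g x) \<le> C"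
    using B by (force simp: C_def)+
  show ?thesis
  proof (rule ac_on_dominated2[OF f g C(1)])
    fix x y assume xy: "a \<le> x" "x \<le> y" "y \<le> b"
    have "f y * g y - f x * g x = (f y - f x) * g y + f x * (g y - g x)"
      by (simp add: algebra_simps)
    also have "norm \<dots> \<le> norm (f y - f x) * norm (g y) + norm (f x) * norm (g y - g x)"
      by (intro order.trans[OF norm_triangle_ineq] add_mono norm_mult_ineq)
    also have "\<dots> \<le> norm (f y - f x) * C + C * norm (g y - g x)"
      by (intro add_mono mult_left_mono mult_right_mono C) (use xy in auto)
    finally show "norm (f y * g y - f x * g x) \<le> C * norm (f y - f x) + C * norm (g y - g x)"
      by (simp add: mult.commute)
  qed
qed

section \<open>Total variation\<close>

text \<open>Non-overlapping families replace ordered partitions. They need not cover the interval,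
  so clipping one at a point or adding one more interval stays within the class; for
  \<open>x \<le> y\<close> the supremum is still the total variation.\<close>

definition variation_sums :: "(real \<Rightarrow> 'a::real_normed_vector) \<Rightarrow> real \<Rightarrow> real \<Rightarrow> real set" where
  "variation_sums f x y = {(\<Sum>i\<in>I. norm (f (v i) - f (u i))) |(I :: nat set) u v.
     finite I \<and> (\<forall>i\<in>I. x \<le> u i \<and> u i \<le> v i \<and> v i \<le> y) \<and>
     disjoint_family_on (\<lambda>i. {u i<..<v i}) I}"

definition variation :: "(real \<Rightarrow> 'a::real_normed_vector) \<Rightarrow> real \<Rightarrow> real \<Rightarrow> real" where
  "variation f x y = Sup (variation_sums f x y)"

lemma sum_length_disjoint_intervals_le:
  fixes u v :: "'i \<Rightarrow> real"
  assumes fin: "finite I" and uv: "\<forall>i\<in>I. x \<le> u i \<and> u i \<le> v i \<and> v i \<le> y"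
    and dis: "disjoint_family_on (\<lambda>i. {u i<..<v i}) I" and "x \<le> y"
  shows "(\<Sum>i\<in>I. v i - u i) \<le> y - x"
proof -
  have "(\<Sum>i\<in>I. v i - u i) = (\<Sum>i\<in>I. measure lborel {u i<..<v i})"
    using uv by (intro sum.cong) auto
  also have "\<dots> = measure lborel (\<Union>i\<in>I. {u i<..<v i})"
    by (rule measure_finite_Union[symmetric]) (use fin dis uv in auto)
  also have "\<dots> \<le> measure lborel {x..y}"
  proof (rule measure_mono_fmeasurable)
    show "(\<Union>i\<in>I. {u i<..<v i}) \<subseteq> {x..y}" using uv by force
  qed (use fin in \<open>auto simp: fmeasurable_cbox[of x y, simplified]\<close>)
  also have "\<dots> = y - x" using \<open>x \<le> y\<close> by simp
  finally show ?thesis .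
qed

lemma zero_in_variation_sums: "0 \<in> variation_sums f x y"
  unfolding variation_sums_def by (rule CollectI, rule exI[of _ "{}"]) (auto simp: disjoint_family_on_def)

text \<open>Subadditivity of the variation at the level of sums. An interval on one side of
  \<open>x\<close> becomes degenerate in the other half; one that contains \<open>x\<close> is
  handled by the triangle inequality through \<open>f x\<close>.\<close>

lemma variation_sums_clip:
  assumes s: "s \<in> variation_sums f a y" and x: "a \<le> x" "x \<le> y"
  shows "\<exists>s1\<in>variation_sums f a x. \<exists>s2\<in>variation_sums f x y. s \<le> s1 + s2"
proof -
  obtain I :: "nat set" and u v where fin: "finite I"
    and uv: "\<forall>i\<in>I. a \<le> u i \<and> u i \<le> v i \<and> v i \<le> y"
    and dis: "disjoint_family_on (\<lambda>i. {u i<..<v i}) I"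
    and s_eq: "s = (\<Sum>i\<in>I. norm (f (v i) - f (u i)))"
    using s unfolding variation_sums_def mem_Collect_eq by (elim exE conjE)
  define s1 where "s1 = (\<Sum>i\<in>I. norm (f (min (v i) x) - f (min (u i) x)))"
  define s2 where "s2 = (\<Sum>i\<in>I. norm (f (max (v i) x) - f (max (u i) x)))"
  have "s1 \<in> variation_sums f a x"
    unfolding variation_sums_def mem_Collect_eq
  proof (intro exI conjI)
    show "disjoint_family_on (\<lambda>i. {min (u i) x<..<min (v i) x}) I"
      by (rule disjoint_family_on_bisimulation[OF dis]) auto
  qed (use fin uv x in \<open>auto simp: s1_def\<close>)
  moreover have "s2 \<in> variation_sums f x y"
    unfolding variation_sums_def mem_Collect_eq
  proof (intro exI conjI)
    show "disjoint_family_on (\<lambda>i. {max (u i) x<..<max (v i) x}) I"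
      by (rule disjoint_family_on_bisimulation[OF dis]) auto
  qed (use fin uv x in \<open>auto simp: s2_def\<close>)
  moreover have "s \<le> s1 + s2"
    unfolding s_eq s1_def s2_def sum.distrib[symmetric]
  proof (rule sum_mono)
    fix i assume "i \<in> I"
    then have "u i \<le> v i" using uv by auto
    then consider "v i \<le> x" | "x \<le> u i" | "u i \<le> x" "x \<le> v i" by linarith
    then show "norm (f (v i) - f (u i)) \<le> norm (f (min (v i) x) - f (min (u i) x)) +
        norm (f (max (v i) x) - f (max (u i) x))"
    proof cases
      case 3
      have "norm (f (v i) - f (u i)) \<le> norm (f x - f (u i)) + norm (f (v i) - f x)"
        using norm_triangle_ineq[of "f x - f (u i)" "f (v i) - f x"] by simp
      with 3 show ?thesis by (simp add: min_def max_def)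
    qed (use \<open>u i \<le> v i\<close> in \<open>auto simp: min_def max_def\<close>)
  qed
  ultimately show ?thesis by blast
qed

lemma variation_sums_append:
  assumes s: "s \<in> variation_sums f a x" and x: "a \<le> x" "x \<le> y"
  shows "s + norm (f y - f x) \<in> variation_sums f a y"
proof -
  obtain I :: "nat set" and u v where fin: "finite I"
    and uv: "\<forall>i\<in>I. a \<le> u i \<and> u i \<le> v i \<and> v i \<le> x"
    and dis: "disjoint_family_on (\<lambda>i. {u i<..<v i}) I"
    and s_eq: "s = (\<Sum>i\<in>I. norm (f (v i) - f (u i)))"
    using s unfolding variation_sums_def mem_Collect_eq by (elim exE conjE)
  obtain j where j: "j \<notin> I" using fin infinite_UNIV_nat by (metis ex_new_if_finite)
  have [simp]: "i \<noteq> j" if "i \<in> I" for i using j that by blast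
  show ?thesis
    unfolding variation_sums_def mem_Collect_eq
  proof (intro exI conjI)
    show "finite (insert j I)" using fin by simp
    show "\<forall>i\<in>insert j I. a \<le> (u(j := x)) i \<and> (u(j := x)) i \<le> (v(j := y)) i \<and> (v(j := y)) i \<le> y"
      using uv x by fastforce
    show "s + norm (f y - f x) = (\<Sum>i\<in>insert j I. norm (f ((v(j := y)) i) - f ((u(j := x)) i)))"
      using fin j by (simp add: s_eq cong: sum.cong)
    show "disjoint_family_on (\<lambda>i. {(u(j := x)) i<..<(v(j := y)) i}) (insert j I)"
      unfolding disjoint_family_on_insert[OF j]
    proof
      show "{(u(j := x)) j<..<(v(j := y)) j} \<inter> (\<Union>i\<in>I. {(u(j := x)) i<..<(v(j := y)) i}) = {}"
        using uv by fastforce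
      show "disjoint_family_on (\<lambda>i. {(u(j := x)) i<..<(v(j := y)) i}) I"
        using dis by (auto simp: disjoint_family_on_def)
    qed
  qed
qed

lemma variation_sums_mono:
  assumes "y \<le> y'"
  shows "variation_sums f a y \<subseteq> variation_sums f a y'"
proof
  fix s assume "s \<in> variation_sums f a y"
  then obtain I :: "nat set" and u v where *: "finite I"
    "\<forall>i\<in>I. a \<le> u i \<and> u i \<le> v i \<and> v i \<le> y"
    "disjoint_family_on (\<lambda>i. {u i<..<v i}) I"
    "s = (\<Sum>i\<in>I. norm (f (v i) - f (u i)))"
    unfolding variation_sums_def mem_Collect_eq by (elim exE conjE)
  show "s \<in> variation_sums f a y'"
    unfolding variation_sums_def mem_Collect_eq
    by (intro exI[of _ I] exI[of _ u] exI[of _ v]) (use * assms in force)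
qed

text \<open>With the modulus \<open>d\<close> for the tolerance 1, every subinterval shorter than
  \<open>d\<close> has variation at most 1, and finitely many of them exhaust
  \<open>{a..b}\<close>.\<close>

lemma ac_on_variation_sums_bounded:
  assumes f: "ac_on a b f" and "a \<le> b"
  shows "bdd_above (variation_sums f a b)"
proof -
  obtain d where d: "d > 0" and *: "\<forall>(I :: nat set) u v. finite I \<longrightarrow>
      (\<forall>i\<in>I. a \<le> u i \<and> u i \<le> v i \<and> v i \<le> b) \<longrightarrow>
        disjoint_family_on (\<lambda>i. {u i<..<v i}) I \<longrightarrow>
        (\<Sum>i\<in>I. v i - u i) < d \<longrightarrow> (\<Sum>i\<in>I. norm (f (v i) - f (u i))) < 1"
    using ac_onD[where 'i = nat, OF f zero_less_one] by (elim exE conjE)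
  have small: "s \<le> 1" if s: "s \<in> variation_sums f x y" and xy: "a \<le> x" "x \<le> y" "y \<le> b" "y - x < d"
    for s x y
  proof -
    obtain I :: "nat set" and u v where I: "finite I"
      "\<forall>i\<in>I. x \<le> u i \<and> u i \<le> v i \<and> v i \<le> y"
      "disjoint_family_on (\<lambda>i. {u i<..<v i}) I"
      "s = (\<Sum>i\<in>I. norm (f (v i) - f (u i)))"
      using s unfolding variation_sums_def mem_Collect_eq by (elim exE conjE)
    have "(\<Sum>i\<in>I. v i - u i) < d"
      using sum_length_disjoint_intervals_le[OF I(1-3) xy(2)] xy by linarith
    then have "s < 1"
      unfolding I(4) by (intro *[rule_format]) (use I xy in force)+
    then show ?thesis by simp
  qed
  \<comment> \<open>Induction on the number \<open>k\<close> of pieces. Their length is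
    \<open>d / 2\<close> rather than \<open>d\<close> because \<open>small\<close> asks for a length
    strictly below \<open>d\<close>.\<close>
  have bound: "s \<le> real k" if "s \<in> variation_sums f a x" "a \<le> x" "x \<le> b" "x \<le> a + real k * (d / 2)"
    for s x k
    using that
  proof (induction k arbitrary: s x)
    case 0
    then have "x = a" by simp
    with 0 obtain I :: "nat set" and u v where I:
      "\<forall>i\<in>I. a \<le> u i \<and> u i \<le> v i \<and> v i \<le> a"
      "s = (\<Sum>i\<in>I. norm (f (v i) - f (u i)))"
      unfolding variation_sums_def mem_Collect_eq by (elim exE conjE) simp
    have "s = 0" unfolding I(2)
    proof (intro sum.neutral ballI)
      fix i assume "i \<in> I"
      then have "u i = a" "v i = a" using I(1) by force+
      then show "norm (f (v i) - f (u i)) = 0" by simp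
    qed
    then show ?case by simp
  next
    case (Suc k)
    define x' where "x' = max a (x - d / 2)"
    have x': "a \<le> x'" "x' \<le> x" "x - x' < d" "x' \<le> a + real k * (d / 2)"
      using Suc.prems d by (auto simp: x'_def max_def field_simps)
    obtain s1 s2 where s: "s1 \<in> variation_sums f a x'" "s2 \<in> variation_sums f x' x" "s \<le> s1 + s2"
      using variation_sums_clip[OF Suc.prems(1) x'(1,2)] by blast
    have "s1 \<le> real k" using Suc.IH[OF s(1)] x' Suc.prems by auto
    moreover have "s2 \<le> 1" using small[OF s(2)] x' Suc.prems by auto
    ultimately show ?case using s(3) by simp
  qed
  obtain k where k: "(b - a) / (d / 2) \<le> real k" using real_arch_simple by blast
  then have "b \<le> a + real k * (d / 2)" using d by (simp add: field_simps)
  then show ?thesis using bound[of _ b k] \<open>a \<le> b\<close> by (intro bdd_aboveI[of _ "real k"]) auto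
qed

text \<open>This inequality makes both parts of the Jordan decomposition monotone: the variation
  itself, and for real \<open>f\<close> also the variation minus \<open>f\<close>.\<close>

lemma variation_increment_ge:
  assumes f: "ac_on a b f" and xy: "a \<le> x" "x \<le> y" "y \<le> b"
  shows "variation f a x + norm (f y - f x) \<le> variation f a y"
proof -
  have bdd: "bdd_above (variation_sums f a y)"
    using ac_on_variation_sums_bounded[OF f] variation_sums_mono[OF xy(3), of f a] xy
    by (meson bdd_above_mono order_trans)
  have "variation f a x \<le> variation f a y - norm (f y - f x)"
    unfolding variation_def
  proof (rule cSup_least)
    show "variation_sums f a x \<noteq> {}" using zero_in_variation_sums by blast
    fix s assume "s \<in> variation_sums f a x"
    from cSup_upper[OF variation_sums_append[OF this xy(1,2)] bdd]
    show "s \<le> Sup (variation_sums f a y) - norm (f y - f x)" by simp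
  qed
  then show ?thesis by simp
qed

text \<open>A nearly optimal sum on \<open>{a..y}\<close> is clipped at \<open>x\<close>. Its left
  part cannot exceed the variation up to \<open>x\<close>, so its right part nearly realizes the
  increment.\<close>

lemma variation_increment_approx:
  assumes f: "ac_on a b f" and xy: "a \<le> x" "x \<le> y" "y \<le> b" and "e > 0"
  shows "\<exists>s\<in>variation_sums f x y. variation f a y - variation f a x \<le> s + e"
proof -
  have bdd: "bdd_above (variation_sums f a z)" if "a \<le> z" "z \<le> b" for z
    using ac_on_variation_sums_bounded[OF f] variation_sums_mono[OF that(2), of f a] that
    by (meson bdd_above_mono order_trans)
  have "variation f a y - e < variation f a y" using \<open>e > 0\<close> by simp
  then obtain s where s: "s \<in> variation_sums f a y" "variation f a y - e < s"
    using less_cSupD[of "variation_sums f a y"] zero_in_variation_sums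
    unfolding variation_def by blast
  obtain s1 s2 where s12: "s1 \<in> variation_sums f a x" "s2 \<in> variation_sums f x y" "s \<le> s1 + s2"
    using variation_sums_clip[OF s(1) xy(1,2)] by blast
  have "s1 \<le> variation f a x"
    unfolding variation_def by (rule cSup_upper[OF s12(1)]) (use bdd xy in auto)
  then show ?thesis using s s12 by (intro bexI[OF _ s12(2)]) simp
qed

text \<open>Inside each interval of a given family a nearly optimal inner family is chosen. All
  inner intervals together, indexed by pairs, are again non-overlapping and no longer in total, so
  the modulus of \<open>f\<close> applies to them.\<close>

lemma ac_on_variation:
  fixes f :: "real \<Rightarrow> 'a::real_normed_vector"
  assumes f: "ac_on a b f"
  shows "ac_on a b (variation f a)"
  unfolding ac_on_def
proof (intro allI impI)
  fix e :: real assume "e > 0"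
  then have e: "e / 2 > 0" by simp
  obtain d where d: "d > 0" and *: "\<forall>(I :: (nat \<times> nat) set) u v. finite I \<longrightarrow>
      (\<forall>i\<in>I. a \<le> u i \<and> u i \<le> v i \<and> v i \<le> b) \<longrightarrow>
        disjoint_family_on (\<lambda>i. {u i<..<v i}) I \<longrightarrow>
        (\<Sum>i\<in>I. v i - u i) < d \<longrightarrow> (\<Sum>i\<in>I. norm (f (v i) - f (u i))) < e / 2"
    using ac_onD[where 'i = "nat \<times> nat", OF f e] by (elim exE conjE)
  show "\<exists>d>0. \<forall>(I :: nat set) u v.
        finite I \<longrightarrow> (\<forall>i\<in>I. a \<le> u i \<and> u i \<le> v i \<and> v i \<le> b) \<longrightarrow>
        disjoint_family_on (\<lambda>i. {u i<..<v i}) I \<longrightarrow>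
        (\<Sum>i\<in>I. v i - u i) < d \<longrightarrow> (\<Sum>i\<in>I. norm (variation f a (v i) - variation f a (u i))) < e"
  proof (intro exI[of _ d] conjI d allI impI)
    fix I :: "nat set" and u v :: "nat \<Rightarrow> real"
    assume fin: "finite I" and uv: "\<forall>i\<in>I. a \<le> u i \<and> u i \<le> v i \<and> v i \<le> b"
      and dis: "disjoint_family_on (\<lambda>i. {u i<..<v i}) I" and sm: "(\<Sum>i\<in>I. v i - u i) < d"
    \<comment> \<open>The approximation error \<eta> is incurred once per interval, hence at most
      \<open>e / 2\<close> in all; the double sum has the other half.\<close>
    define \<eta> where "\<eta> = e / (2 * (real (card I) + 1))"
    have \<eta>: "\<eta> > 0" using \<open>e > 0\<close> by (simp add: \<eta>_def)
    define good where "good i J p q \<longleftrightarrow> finite (J :: nat set) \<and>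
        (\<forall>j\<in>J. u i \<le> p j \<and> p j \<le> q j \<and> q j \<le> v i) \<and>
        disjoint_family_on (\<lambda>j. {p j<..<q j}) J \<and>
        variation f a (v i) - variation f a (u i) \<le> (\<Sum>j\<in>J. norm (f (q j) - f (p j))) + \<eta>"
      for i J p q
    have "\<exists>J p q. good i J p q" if "i \<in> I" for i
    proof -
      have "a \<le> u i" "u i \<le> v i" "v i \<le> b" using uv that by auto
      from variation_increment_approx[OF f this \<eta>]
      obtain s where "s \<in> variation_sums f (u i) (v i)"
        "variation f a (v i) - variation f a (u i) \<le> s + \<eta>" by blast
      then show ?thesis unfolding variation_sums_def good_def by blast
    qed
    then obtain J p q where good: "\<And>i. i \<in> I \<Longrightarrow> good i (J i) (p i) (q i)" by metis
    have J: "finite (J i)"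
      and pq: "\<forall>j\<in>J i. u i \<le> p i j \<and> p i j \<le> q i j \<and> q i j \<le> v i"
      and disJ: "disjoint_family_on (\<lambda>j. {p i j<..<q i j}) (J i)"
      and V: "variation f a (v i) - variation f a (u i) \<le>
                 (\<Sum>j\<in>J i. norm (f (q i j) - f (p i j))) + \<eta>" if "i \<in> I" for i
      using good[OF that] unfolding good_def by blast+
    have "(\<Sum>ij\<in>Sigma I J. norm (f (case_prod q ij) - f (case_prod p ij))) < e / 2"
    proof (rule *[rule_format])
      show "finite (Sigma I J)" using fin J by blast
      show "a \<le> case_prod p ij \<and> case_prod p ij \<le> case_prod q ij \<and> case_prod q ij \<le> b"
        if "ij \<in> Sigma I J" for ij
        using that uv pq by fastforce
      show "disjoint_family_on (\<lambda>ij. {case_prod p ij<..<case_prod q ij}) (Sigma I J)"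
        unfolding disjoint_family_on_def
      proof (intro ballI impI)
        fix x y assume xy: "x \<in> Sigma I J" "y \<in> Sigma I J" "x \<noteq> y"
        obtain i j i' j' where e: "x = (i, j)" "y = (i', j')" by fastforce
        show "{case_prod p x<..<case_prod q x} \<inter> {case_prod p y<..<case_prod q y} = {}"
        proof (cases "i = i'")
          case True
          then show ?thesis using disJ[of i] xy e by (auto simp: disjoint_family_on_def)
        next
          case False
          have "{p i j<..<q i j} \<subseteq> {u i<..<v i}" "{p i' j'<..<q i' j'} \<subseteq> {u i'<..<v i'}"
            using pq[of i] pq[of i'] xy e by force+
          moreover have "{u i<..<v i} \<inter> {u i'<..<v i'} = {}"
            using dis False xy e unfolding disjoint_family_on_def by blast
          ultimately show ?thesis unfolding e by (simp only: prod.case) blast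
        qed
      qed
      have "(\<Sum>ij\<in>Sigma I J. case_prod q ij - case_prod p ij) = (\<Sum>i\<in>I. \<Sum>j\<in>J i. q i j - p i j)"
        using fin J by (subst sum.Sigma) (auto simp: case_prod_beta)
      also have "\<dots> \<le> (\<Sum>i\<in>I. v i - u i)"
        by (intro sum_mono sum_length_disjoint_intervals_le J pq disJ) (use uv in auto)
      finally show "(\<Sum>ij\<in>Sigma I J. case_prod q ij - case_prod p ij) < d" using sm by simp
    qed
    also have "(\<Sum>ij\<in>Sigma I J. norm (f (case_prod q ij) - f (case_prod p ij)))
        = (\<Sum>i\<in>I. \<Sum>j\<in>J i. norm (f (q i j) - f (p i j)))"
      using fin J by (subst sum.Sigma) (auto simp: case_prod_beta)
    finally have S: "(\<Sum>i\<in>I. \<Sum>j\<in>J i. norm (f (q i j) - f (p i j))) < e / 2" .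
    have "(\<Sum>i\<in>I. norm (variation f a (v i) - variation f a (u i))) \<le>
        (\<Sum>i\<in>I. (\<Sum>j\<in>J i. norm (f (q i j) - f (p i j))) + \<eta>)"
    proof (rule sum_mono)
      fix i assume i: "i \<in> I"
      then have "variation f a (u i) + norm (f (v i) - f (u i)) \<le> variation f a (v i)"
        using uv by (intro variation_increment_ge[OF f]) auto
      then have "variation f a (u i) \<le> variation f a (v i)"
        using norm_ge_zero[of "f (v i) - f (u i)"] by linarith
      then show "norm (variation f a (v i) - variation f a (u i)) \<le>
          (\<Sum>j\<in>J i. norm (f (q i j) - f (p i j))) + \<eta>"
        using V[OF i] by simp
    qed
    also have "\<dots> = (\<Sum>i\<in>I. \<Sum>j\<in>J i. norm (f (q i j) - f (p i j))) + real (card I) * \<eta>"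
      by (simp add: sum.distrib)
    also have "real (card I) * \<eta> \<le> e / 2"
      using \<open>e > 0\<close> by (simp add: \<eta>_def field_simps)
    finally show "(\<Sum>i\<in>I. norm (variation f a (v i) - variation f a (u i))) < e" using S by simp
  qed
qed

section \<open>The fundamental theorem of calculus for absolutely continuous functions\<close>

text \<open>Composition with the clamp extends a function on \<open>{a..b}\<close> by constants to
  the whole line, as the Stieltjes measure requires, without creating mass outside
  \<open>{a..b}\<close>.\<close>

definition clamp_to :: "real \<Rightarrow> real \<Rightarrow> real \<Rightarrow> real" where
  "clamp_to a b x = max a (min b x)"

lemma clamp_to_simps [simp]:
  assumes "a \<le> b"
  shows "a \<le> clamp_to a b x" "clamp_to a b x \<le> b"
    "x \<le> y \<Longrightarrow> clamp_to a b x \<le> clamp_to a b y"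
    "x \<in> {a..b} \<Longrightarrow> clamp_to a b x = x"
  using assms by (auto simp: clamp_to_def)

section \<open>Stieltjes measures of monotone absolutely continuous functions and their
  densities\<close>

lemma ac_on_clamp_continuous:
  assumes "ac_on a b f" "a \<le> b"
  shows "continuous_on UNIV (\<lambda>x. f (clamp_to a b x))"
proof (rule continuous_on_compose2[OF ac_on_imp_continuous_on[OF assms(1)]])
  show "continuous_on UNIV (clamp_to a b)"
    unfolding clamp_to_def by (intro continuous_intros)
qed (use assms in auto)

text \<open>The defining estimate of absolute continuity, carried from finite families of intervals
  to open sets. The open set is exhausted by finite unions of boxes; each union is cut into
  non-overlapping intervals, whose measures are increments of \<open>G\<close>, and continuity from
  below gives the limit.\<close>

lemma ac_on_interval_measure_open_le:
  fixes G :: "real \<Rightarrow> real"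
  assumes ab: "a \<le> b"
    and mono: "\<And>x y. x \<le> y \<Longrightarrow> G (clamp_to a b x) \<le> G (clamp_to a b y)"
    and cont: "continuous_on UNIV (\<lambda>x. G (clamp_to a b x))"
    and d: "\<forall>(I :: real set set) u v. finite I \<longrightarrow>
      (\<forall>i\<in>I. a \<le> u i \<and> u i \<le> v i \<and> v i \<le> b) \<longrightarrow>
        disjoint_family_on (\<lambda>i. {u i<..<v i}) I \<longrightarrow>
        (\<Sum>i\<in>I. v i - u i) < d \<longrightarrow> (\<Sum>i\<in>I. norm (G (v i) - G (u i))) < e"
    and T: "open T" "emeasure lborel T < ennreal d"
  shows "emeasure (interval_measure (\<lambda>x. G (clamp_to a b x))) T \<le> ennreal e"
proof -
  define N where "N = interval_measure (\<lambda>x. G (clamp_to a b x))"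
  have [simp]: "sets N = sets borel" by (simp add: N_def)
  have d0: "d > 0" using T(2) by (metis ennreal_neg not_le not_less_zero)
  obtain \<D> :: "real set set" where D: "countable \<D>" "\<And>X. X \<in> \<D> \<Longrightarrow> \<exists>l r. X = cbox l r" "\<Union>\<D> = T"
    using open_countable_Union_open_cbox[OF T(1)] by metis
  \<comment> \<open>The added empty set makes the enumerated set nonempty, so that the range is
    right even for an empty cover.\<close>
  define \<C> where "\<C> = (\<lambda>n. from_nat_into (insert {} \<D>) n)"
  have rC: "range \<C> = insert {} \<D>" unfolding \<C>_def
    by (rule range_from_nat_into) (use D in auto)
  have C: "\<exists>l r. \<C> n = cbox l r" for n
  proof -
    have "\<C> n \<in> insert {} \<D>" using rC by blast
    then show ?thesis using D(2) empty_as_interval by (metis insertE)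
  qed
  define U where "U n = (\<Union>i<n. \<C> i)" for n :: nat
  have UT: "(\<Union>n. U n) = T"
  proof -
    have "(\<Union>n. U n) = \<Union>(range \<C>)" unfolding U_def by auto
    then show ?thesis using rC D by simp
  qed
  have Cb: "\<C> n \<in> sets borel" for n using C[of n] by auto
  have Ub: "U n \<in> sets borel" for n unfolding U_def using Cb by auto
  have le: "emeasure N (U n) \<le> ennreal e" for n
  proof -
    \<comment> \<open>The boxes may overlap. A division of their union has disjoint interiors, which
      is what the hypothesis on families requires.\<close>
    obtain p where p: "p division_of (\<Union>(\<C> ` {..<n}))"
      using elementary_unions_intervals[of "\<C> ` {..<n}"] C by (metis finite_imageI finite_lessThan imageE)
    then have pU: "p division_of (U n)" by (simp add: U_def)
    \<comment> \<open>The hypothesis speaks of points of \<open>{a..b}\<close> only, hence the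
      clamped endpoints. Clamping shortens the intervals and leaves the increments of the clamped
      function unchanged.\<close>
    define u v where "u K = clamp_to a b (Inf K)" and "v K = clamp_to a b (Sup K)" for K :: "real set"
    have K: "K = {Inf K..Sup K} \<and> Inf K \<le> Sup K" if "K \<in> p" for K
    proof -
      have "K \<noteq> {}" "\<exists>l r. K = cbox l r"
        using division_ofD(3,4)[OF pU] that by blast+
      then obtain l r where "K = cbox l r" "K \<noteq> {}" by blast
      then show ?thesis by auto
    qed
    have fp: "finite p" using pU by blast
    have Kb: "K \<in> sets borel" if "K \<in> p" for K
      using K[OF that] by (metis atLeastAtMost_borel)
    have "emeasure N (U n) = emeasure N (\<Union>K\<in>p. K)"
      using division_ofD(6)[OF pU] by simp
    also have "\<dots> \<le> (\<Sum>K\<in>p. emeasure N K)"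
      by (rule emeasure_subadditive_finite) (use fp Kb in auto)
    also have "\<dots> = (\<Sum>K\<in>p. ennreal (norm (G (v K) - G (u K))))"
    proof (rule sum.cong)
      fix K assume "K \<in> p"
      from K[OF this] have K': "K = {Inf K..Sup K}" "Inf K \<le> Sup K" by auto
      have "emeasure N {Inf K..Sup K} = ennreal (G (v K) - G (u K))"
        unfolding N_def u_def v_def
        by (rule emeasure_interval_measure_Icc[OF K'(2) mono cont])
      moreover have "G (u K) \<le> G (v K)" using mono K'(2) by (simp add: u_def v_def)
      ultimately show "emeasure N K = ennreal (norm (G (v K) - G (u K)))"
        using K'(1) by simp
    qed simp
    also have "\<dots> = ennreal (\<Sum>K\<in>p. norm (G (v K) - G (u K)))" by (simp add: sum_ennreal)
    also have "\<dots> \<le> ennreal e"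
    proof (intro ennreal_leI less_imp_le d[rule_format])
      show "finite p" by fact
      show "a \<le> u K \<and> u K \<le> v K \<and> v K \<le> b" if "K \<in> p" for K
        using K[OF that] ab by (auto simp: u_def v_def)
      show "disjoint_family_on (\<lambda>i. {u i<..<v i}) p"
        unfolding disjoint_family_on_def
      proof (intro ballI impI)
        fix K L assume KL: "K \<in> p" "L \<in> p" "K \<noteq> L"
        have int: "{u M<..<v M} \<subseteq> interior M" if "M \<in> p" for M
        proof -
          have "{u M<..<v M} \<subseteq> {Inf M<..<Sup M}"
            by (auto simp: u_def v_def clamp_to_def)
          also have "\<dots> = interior M"
            using K[OF that] by (metis interior_atLeastAtMost_real)
          finally show ?thesis .
        qed
        have "interior K \<inter> interior L = {}" using division_ofD(5)[OF pU KL] .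
        then show "{u K<..<v K} \<inter> {u L<..<v L} = {}" using int[OF KL(1)] int[OF KL(2)] by blast
      qed
      have "(\<Sum>K\<in>p. v K - u K) \<le> (\<Sum>K\<in>p. measure lebesgue K)"
      proof (rule sum_mono)
        fix K assume "K \<in> p"
        from K[OF this] have K': "K = {Inf K..Sup K}" "Inf K \<le> Sup K" by auto
        have "measure lebesgue {Inf K..Sup K} = Sup K - Inf K" using K'(2) by simp
        moreover have "v K - u K \<le> Sup K - Inf K"
          using K'(2) ab by (auto simp: u_def v_def clamp_to_def)
        ultimately show "v K - u K \<le> measure lebesgue K" using K'(1) by simp
      qed
      also have "\<dots> = measure lebesgue (U n)" by (rule content_division[OF pU])
      also have "\<dots> < d"
      proof -
        have "emeasure lborel (U n) \<le> emeasure lborel T"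
          using UT Ub T by (intro emeasure_mono) auto
        then have "emeasure lborel (U n) < ennreal d" using T(2) by (rule le_less_trans)
        moreover from this have "emeasure lborel (U n) = ennreal (measure lborel (U n))"
          by (intro emeasure_eq_ennreal_measure) auto
        ultimately have "measure lborel (U n) < d" by (simp add: ennreal_less_iff)
        then show ?thesis using Ub by simp
      qed
      finally show "(\<Sum>K\<in>p. v K - u K) < d" .
    qed
    finally show ?thesis .
  qed
  have "(SUP n. emeasure N (U n)) = emeasure N (\<Union>n. U n)"
    by (rule SUP_emeasure_incseq) (use Ub in \<open>auto simp: incseq_def U_def intro: less_le_trans\<close>)
  then have "emeasure N T = (SUP n. emeasure N (U n))" using UT by simp
  also have "\<dots> \<le> ennreal e" by (rule SUP_least) (rule le)
  finally show ?thesis by (simp add: N_def)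
qed

text \<open>The conclusion covers all intervals of the line, not only those inside
  \<open>{a..b}\<close>, because this is the form of hypothesis in
  \<open>indefinite_integral_deriv\<close>.\<close>

lemma ac_on_mono_density:
  fixes G :: "real \<Rightarrow> real"
  assumes ab: "a \<le> b" and G: "ac_on a b G"
    and mono: "\<And>x y. a \<le> x \<Longrightarrow> x \<le> y \<Longrightarrow> y \<le> b \<Longrightarrow> G x \<le> G y"
  shows "\<exists>g. integrable lborel g \<and>
    (\<forall>x y. x \<le> y \<longrightarrow> (g has_integral (G (clamp_to a b y) - G (clamp_to a b x))) {x..y})"
proof -
  define F where "F = (\<lambda>x. G (clamp_to a b x))"
  have monoF: "\<And>x y. x \<le> y \<Longrightarrow> F x \<le> F y" unfolding F_def by (intro mono) (use ab in auto)
  have contF: "continuous_on UNIV F" unfolding F_def by (rule ac_on_clamp_continuous[OF G ab])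
  have rcF: "continuous (at_right x) F" for x
    using contF by (simp add: continuous_on_eq_continuous_within continuous_within_subset[of x UNIV])
  define N where "N = interval_measure F"
  have N_Ioc: "emeasure N {x<..y} = ennreal (F y - F x)" if "x \<le> y" for x y
    unfolding N_def using emeasure_interval_measure_Ioc[OF that monoF rcF] .
  \<comment> \<open>By outer regularity a null set lies in open sets of arbitrarily small Lebesgue
    measure, and these have small Stieltjes measure by the preceding lemma.\<close>
  have ac: "absolutely_continuous lborel N"
    unfolding absolutely_continuous_def
  proof
    fix A :: "real set" assume "A \<in> null_sets lborel"
    then have A: "A \<in> sets borel" "emeasure lborel A = 0" by auto
    have "emeasure N A \<le> ennreal e" if "e > 0" for e
    proof -
      obtain d where d: "d > 0" and *: "\<forall>(I :: real set set) u v. finite I \<longrightarrow>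
          (\<forall>i\<in>I. a \<le> u i \<and> u i \<le> v i \<and> v i \<le> b) \<longrightarrow>
          disjoint_family_on (\<lambda>i. {u i<..<v i}) I \<longrightarrow>
          (\<Sum>i\<in>I. v i - u i) < d \<longrightarrow> (\<Sum>i\<in>I. norm (G (v i) - G (u i))) < e"
        using ac_onD[where 'i = "real set", OF G \<open>e > 0\<close>] by (elim exE conjE)
      obtain T where T: "open T" "A \<subseteq> T" "emeasure lebesgue (T - A) < ennreal d"
        using sets_lebesgue_outer_open[OF _ d, of A] A(1) by (metis sets_completionI_sets sets_lborel)
      have "emeasure lborel T = emeasure lborel (T - A)"
        using A T by (intro emeasure_Diff_null_set[symmetric]) auto
      also have "\<dots> < ennreal d" using T A by simp
      finally have "emeasure lborel T < ennreal d" .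
      then have "emeasure N T \<le> ennreal e"
        unfolding N_def F_def
        by (intro ac_on_interval_measure_open_le[OF ab _ _ * T(1)])
          (use monoF contF in \<open>auto simp: F_def\<close>)
      moreover have "emeasure N A \<le> emeasure N T"
        using T by (intro emeasure_mono) (auto simp: N_def)
      ultimately show ?thesis by order
    qed
    then have "emeasure N A = 0"
      using ennreal_le_epsilon[of 0 "emeasure N A"] by simp
    then show "A \<in> null_sets N" using A by (auto simp: N_def)
  qed
  obtain h where h: "h \<in> borel_measurable borel" "density lborel h = N"
    using sigma_finite_measure.Radon_Nikodym[OF lborel.sigma_finite_measure_axioms ac] by (auto simp: N_def)
  have hIoc: "(\<integral>\<^sup>+t. h t * indicator {x<..y} t \<partial>lborel) = ennreal (F y - F x)" if "x \<le> y" for x y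
    using N_Ioc[OF that] h(1) by (subst (asm) h(2)[symmetric]) (simp add: emeasure_density)
  \<comment> \<open>The constant extension bounds the total mass by \<open>F b - F a\<close>. This
    makes \<open>h\<close> finite almost everywhere and its real version \<open>g\<close>
    integrable.\<close>
  have fin: "(\<integral>\<^sup>+t. h t \<partial>lborel) \<le> ennreal (F b - F a)"
  proof -
    have "(\<integral>\<^sup>+t. h t \<partial>lborel) = emeasure N UNIV"
      using h(1) by (subst h(2)[symmetric]) (simp add: emeasure_density)
    also have "(UNIV :: real set) = (\<Union>n. {a - real n<..b + real n})"
    proof -
      have "\<exists>n. x \<in> {a - real n<..b + real n}" for x
      proof -
        obtain n where "\<bar>x\<bar> + \<bar>a\<bar> + \<bar>b\<bar> < real n" using reals_Archimedean2 by blast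
        then show ?thesis by (intro exI[of _ n]) auto
      qed
      then show ?thesis by blast
    qed
    also have "emeasure N \<dots> = (SUP n. emeasure N {a - real n<..b + real n})"
      by (rule SUP_emeasure_incseq[symmetric]) (auto simp: N_def incseq_def)
    also have "\<dots> \<le> ennreal (F b - F a)"
    proof (rule SUP_least)
      fix n :: nat
      have "F (b + real n) = F b" "F (a - real n) = F a"
        using ab by (simp_all add: F_def clamp_to_def)
      then show "emeasure N {a - real n<..b + real n} \<le> ennreal (F b - F a)"
        using ab by (subst N_Ioc) auto
    qed
    finally show ?thesis .
  qed
  have aefin: "AE t in lborel. h t \<noteq> \<infinity>"
    by (rule nn_integral_PInf_AE) (use h(1) fin in \<open>auto simp: top_unique\<close>)
  define g where "g t = enn2real (h t)" for t
  have gm[measurable]: "g \<in> borel_measurable borel" unfolding g_def using h(1) by measurable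
  have gh: "AE t in lborel. ennreal (g t) = h t"
    using aefin by eventually_elim (simp add: g_def less_top)
  have gint: "integrable lborel g"
  proof (rule integrableI_nonneg)
    have "(\<integral>\<^sup>+t. ennreal (g t) \<partial>lborel) = (\<integral>\<^sup>+t. h t \<partial>lborel)"
      by (rule nn_integral_cong_AE[OF gh])
    then show "(\<integral>\<^sup>+t. ennreal (g t) \<partial>lborel) < \<infinity>"
      using fin by (metis ennreal_less_top infinity_ennreal_def le_less_trans)
  qed (auto simp: g_def)
  have "(g has_integral (F y - F x)) {x..y}" if "x \<le> y" for x y
  proof -
    have "has_bochner_integral lborel (\<lambda>t. indicator {x<..y} t *\<^sub>R g t) (F y - F x)"
    proof (rule has_bochner_integral_nn_integral)
      have "(\<integral>\<^sup>+t. ennreal (indicator {x<..y} t *\<^sub>R g t) \<partial>lborel)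
          = (\<integral>\<^sup>+t. h t * indicator {x<..y} t \<partial>lborel)"
        by (rule nn_integral_cong_AE) (use gh in \<open>eventually_elim, auto simp: indicator_def\<close>)
      then show "(\<integral>\<^sup>+t. ennreal (indicator {x<..y} t *\<^sub>R g t) \<partial>lborel) = ennreal (F y - F x)"
        using hIoc[OF that] by simp
      show "(\<lambda>t. indicator {x<..y} t *\<^sub>R g t) \<in> borel_measurable lborel" by measurable
    qed (use monoF[OF that] in \<open>auto simp: g_def\<close>)
    then have "((\<lambda>t. indicator {x<..y} t *\<^sub>R g t) has_integral (F y - F x)) UNIV"
      by (metis has_bochner_integral_iff has_integral_integral_lborel)
    also have "(\<lambda>t. indicator {x<..y} t *\<^sub>R g t) = (\<lambda>t. if t \<in> {x<..y} then g t else 0)"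
      by (auto simp: indicator_def)
    finally have "(g has_integral (F y - F x)) {x<..y}"
      by (simp only: has_integral_restrict_UNIV)
    moreover have "negligible {t \<in> {x<..y} - {x..y}. g t \<noteq> 0}"
      by (rule negligible_subset[of "{}"]) auto
    moreover have "negligible {t \<in> {x..y} - {x<..y}. g t \<noteq> 0}"
      by (rule negligible_subset[of "{x}"]) auto
    ultimately show ?thesis
      using has_integral_spike_set_eq[of "{x<..y}" "{x..y}" g] by blast
  qed
  then show ?thesis using gint unfolding F_def by blast
qed

text \<open>With V the variation from \<open>a\<close>, the density of \<open>F\<close> is the
  difference of the densities of the monotone functions V and V - F.\<close>

lemma ac_on_real_density:
  fixes F :: "real \<Rightarrow> real"
  assumes ab: "a \<le> b" and F: "ac_on a b F"
  shows "\<exists>g. integrable lborel g \<and>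
    (\<forall>x y. x \<le> y \<longrightarrow> (g has_integral (F (clamp_to a b y) - F (clamp_to a b x))) {x..y})"
proof -
  have V: "variation F a x + norm (F y - F x) \<le> variation F a y"
    if "a \<le> x" "x \<le> y" "y \<le> b" for x y
    by (rule variation_increment_ge[OF F that])
  obtain g where g: "integrable lborel g" "\<And>x y. x \<le> y \<Longrightarrow>
      (g has_integral (variation F a (clamp_to a b y) - variation F a (clamp_to a b x))) {x..y}"
    using ac_on_mono_density[OF ab ac_on_variation[OF F]] V norm_ge_zero
    by (metis (no_types, lifting) add_increasing2 order.refl order_trans)
  have "variation F a x - F x \<le> variation F a y - F y" if "a \<le> x" "x \<le> y" "y \<le> b" for x y
    using V[OF that] by simp
  from ac_on_mono_density[OF ab ac_on_diff[OF ac_on_variation[OF F] F] this]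
  obtain g' where g': "integrable lborel g'" "\<And>x y. x \<le> y \<Longrightarrow>
      (g' has_integral ((variation F a (clamp_to a b y) - F (clamp_to a b y)) -
         (variation F a (clamp_to a b x) - F (clamp_to a b x)))) {x..y}"
    by blast
  show ?thesis
  proof (intro exI conjI allI impI)
    show "integrable lborel (\<lambda>t. g t - g' t)" using g g' by simp
    fix x y :: real assume "x \<le> y"
    from has_integral_diff[OF g(2)[OF this] g'(2)[OF this]]
    show "((\<lambda>t. g t - g' t) has_integral (F (clamp_to a b y) - F (clamp_to a b x))) {x..y}"
      by simp
  qed
qed

lemma ac_on_complex_density:
  fixes f :: "real \<Rightarrow> complex"
  assumes ab: "a \<le> b" and f: "ac_on a b f"
  shows "\<exists>g. integrable lborel g \<and>
    (\<forall>x y. x \<le> y \<longrightarrow> (g has_integral (f (clamp_to a b y) - f (clamp_to a b x))) {x..y})"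
proof -
  obtain g where g: "integrable lborel g" "\<And>x y. x \<le> y \<Longrightarrow>
      (g has_integral (Re (f (clamp_to a b y)) - Re (f (clamp_to a b x)))) {x..y}"
    using ac_on_real_density[OF ab ac_on_bounded_linear[OF bounded_linear_Re f]] by blast
  obtain h where h: "integrable lborel h" "\<And>x y. x \<le> y \<Longrightarrow>
      (h has_integral (Im (f (clamp_to a b y)) - Im (f (clamp_to a b x)))) {x..y}"
    using ac_on_real_density[OF ab ac_on_bounded_linear[OF bounded_linear_Im f]] by blast
  show ?thesis
  proof (intro exI conjI allI impI)
    show "integrable lborel (\<lambda>t. Complex (g t) (h t))"
      unfolding Complex_eq using g(1) h(1) by simp
    fix x y :: real assume "x \<le> y"
    have "((\<lambda>t. complex_of_real (g t) + \<i> * complex_of_real (h t)) has_integral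
       (of_real (Re (f (clamp_to a b y)) - Re (f (clamp_to a b x))) +
        \<i> * of_real (Im (f (clamp_to a b y)) - Im (f (clamp_to a b x))))) {x..y}"
      by (intro has_integral_add has_integral_of_real has_integral_mult_right g h \<open>x \<le> y\<close>)
    also have "(of_real (Re (f (clamp_to a b y)) - Re (f (clamp_to a b x))) +
        \<i> * of_real (Im (f (clamp_to a b y)) - Im (f (clamp_to a b x)))) =
        f (clamp_to a b y) - f (clamp_to a b x)"
      by (simp add: complex_eq_iff)
    finally show "((\<lambda>t. Complex (g t) (h t)) has_integral (f (clamp_to a b y) - f (clamp_to a b x))) {x..y}"
      by (simp add: Complex_eq)
  qed
qed

section \<open>Differentiation of indefinite integrals\<close>

lemma indefinite_integral_deriv_right:
  fixes g :: "real \<Rightarrow> 'a::euclidean_space"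
  assumes "\<And>x y. x \<le> y \<Longrightarrow> (g has_integral (F y - F x)) {x..y}"
  obtains N where "negligible N"
    "\<And>x. x \<notin> N \<Longrightarrow> ((\<lambda>y. (F y - F x) /\<^sub>R (y - x)) \<longlongrightarrow> g x) (at_right x)"
proof -
  have "g integrable_on cbox x y" for x y
    using assms[of x y] by (cases "x \<le> y") (auto simp: integrable_on_def intro: has_integral_empty)
  \<comment> \<open>The averages in this theorem run over boxes whose lower corner is
    \<open>x\<close>, so only right-hand difference quotients are obtained.\<close>
  from integrable_ccontinuous_explicit[OF this]
  obtain N where N: "negligible N"
       "\<And>x e. \<lbrakk>x \<notin> N; 0 < e\<rbrakk> \<Longrightarrow> \<exists>d>0. \<forall>h. 0 < h \<and> h < d \<longrightarrow>
            norm (integral (cbox x (x + h *\<^sub>R One)) g /\<^sub>R h ^ DIM(real) - g x) < e"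
    by blast
  show thesis
  proof (rule that[OF N(1)])
    fix x assume x: "x \<notin> N"
    show "((\<lambda>y. (F y - F x) /\<^sub>R (y - x)) \<longlongrightarrow> g x) (at_right x)"
    proof (rule tendstoI)
      fix e :: real assume "e > 0"
      obtain d where d: "d > 0" "\<And>h. 0 < h \<Longrightarrow> h < d \<Longrightarrow>
            norm (integral (cbox x (x + h *\<^sub>R One)) g /\<^sub>R h ^ DIM(real) - g x) < e"
        using N(2)[OF x \<open>e > 0\<close>] by blast
      have "dist ((F y - F x) /\<^sub>R (y - x)) (g x) < e" if "x < y" "y < x + d" for y
        using d(2)[of "y - x"] that integral_unique[OF assms[of x y]] by (simp add: dist_norm)
      then show "\<forall>\<^sub>F y in at_right x. dist ((F y - F x) /\<^sub>R (y - x)) (g x) < e"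
        using d(1) by (intro eventually_at_rightI[of x "x + d"]) auto
    qed
  qed
qed

text \<open>The left-hand derivative is obtained by reflecting the right-hand one.\<close>

lemma indefinite_integral_deriv:
  fixes g :: "real \<Rightarrow> 'a::euclidean_space"
  assumes g: "\<And>x y. x \<le> y \<Longrightarrow> (g has_integral (F y - F x)) {x..y}"
  obtains N where "negligible N" "\<And>x. x \<notin> N \<Longrightarrow> (F has_vector_derivative g x) (at x)"
proof -
  obtain N1 where N1: "negligible N1"
    "\<And>x. x \<notin> N1 \<Longrightarrow> ((\<lambda>y. (F y - F x) /\<^sub>R (y - x)) \<longlongrightarrow> g x) (at_right x)"
    using indefinite_integral_deriv_right[OF g] by blast
  have "((\<lambda>t. g (- t)) has_integral ((- F (- y)) - (- F (- x)))) {x..y}" if "x \<le> y" for x y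
    using has_integral_reflect_real[where f = g and a = "- y" and b = "- x"] g[of "- y" "- x"] that
    by simp
  from indefinite_integral_deriv_right[OF this]
  obtain N2 where N2: "negligible N2"
    "\<And>x. x \<notin> N2 \<Longrightarrow> ((\<lambda>y. (- F (- y) - - F (- x)) /\<^sub>R (y - x)) \<longlongrightarrow> g (- x)) (at_right x)"
    by blast
  show thesis
  proof
    show "negligible (N1 \<union> uminus ` N2)"
      using N1(1) N2(1)
      by (intro negligible_Un negligible_differentiable_image_negligible)
        (auto intro!: differentiable_on_minus differentiable_on_ident)
    fix x assume x: "x \<notin> N1 \<union> uminus ` N2"
    then have x2: "- x \<notin> N2" by (metis UnCI image_eqI minus_minus)
    have "((\<lambda>y. (F y - F x) /\<^sub>R (y - x)) \<longlongrightarrow> g x) (at_left x)"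
      unfolding filterlim_at_left_to_right
    proof -
      have "(- F (- y) - - F (- (- x))) /\<^sub>R (y - - x) = (F (- y) - F x) /\<^sub>R (- y - x)" for y
      proof -
        have "inverse (- y - x) = - inverse (y + x)" by (metis inverse_minus_eq minus_add_distrib uminus_add_conv_diff add_uminus_conv_diff)
        then show ?thesis by (simp add: scaleR_diff_right)
      qed
      then show "((\<lambda>y. (F (- y) - F x) /\<^sub>R (- y - x)) \<longlongrightarrow> g x) (at_right (- x))"
        using N2(2)[OF x2] by simp
    qed
    with N1(2)[of x] x have "((\<lambda>y. (F y - F x) /\<^sub>R (y - x)) \<longlongrightarrow> g x) (at x)"
      by (simp add: filterlim_split_at)
    then have "((\<lambda>y. norm ((F y - F x) /\<^sub>R (y - x) - g x)) \<longlongrightarrow> 0) (at x)"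
      by (intro tendsto_norm_zero LIM_zero)
    then have "((\<lambda>y. norm (F y - F x - (y - x) *\<^sub>R g x) / norm (y - x)) \<longlongrightarrow> 0) (at x)"
    proof (rule Lim_transform_eventually)
      have "norm ((F y - F x) /\<^sub>R (y - x) - g x) = norm (F y - F x - (y - x) *\<^sub>R g x) / norm (y - x)"
        if "y \<noteq> x" for y
      proof -
        have "(F y - F x) /\<^sub>R (y - x) - g x = (F y - F x - (y - x) *\<^sub>R g x) /\<^sub>R (y - x)"
          using that by (simp add: scaleR_diff_right)
        then show ?thesis by (simp add: divide_inverse mult.commute)
      qed
      then show "\<forall>\<^sub>F y in at x. norm ((F y - F x) /\<^sub>R (y - x) - g x) =
          norm (F y - F x - (y - x) *\<^sub>R g x) / norm (y - x)"
        by (auto simp: eventually_at_filter)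
    qed
    then show "(F has_vector_derivative g x) (at x)"
      by (simp add: has_vector_derivative_def has_derivative_iff_norm bounded_linear_scaleR_left)
  qed
qed

text \<open>Near a point of the open interval the clamped function is \<open>f\<close> itself, so
  the density is a two-sided derivative of \<open>f\<close> almost everywhere. This serves three
  purposes: integration by parts for a product, and derivatives of the cut-off and of the derivative
  of the eigenfunction.\<close>

lemma ac_on_fundamental:
  fixes f :: "real \<Rightarrow> complex"
  assumes ab: "a < b" and f: "ac_on a b f"
  obtains g where "integrable (lebesgue_on {a<..<b}) g"
    "AE x in lebesgue_on {a<..<b}. (f has_vector_derivative g x) (at x)"
    "(LINT x|lebesgue_on {a<..<b}. g x) = f b - f a"
proof -
  obtain g where g: "integrable lborel g" "\<And>x y. x \<le> y \<Longrightarrow>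
      (g has_integral (f (clamp_to a b y) - f (clamp_to a b x))) {x..y}"
    using ac_on_complex_density[OF _ f] ab by (metis less_imp_le)
  obtain N where N: "negligible N" "\<And>x. x \<notin> N \<Longrightarrow>
      ((\<lambda>x. f (clamp_to a b x)) has_vector_derivative g x) (at x)"
    using indefinite_integral_deriv[OF g(2)] by blast
  show thesis
  proof
    have "integrable lebesgue g" using g(1) by (simp add: integrable_completion)
    then show int: "integrable (lebesgue_on {a<..<b}) g"
      by (simp add: integrable_mult_indicator integrable_restrict_space)
    have "AE x in lebesgue. x \<notin> N"
      using N(1) by (simp add: negligible_iff_null_sets AE_not_in)
    then have "AE x in lebesgue_on {a<..<b}. x \<notin> N"
      by (subst AE_restrict_space_iff) auto
    moreover have "AE x in lebesgue_on {a<..<b}. x \<in> {a<..<b}"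
      by (rule AE_I2) auto
    ultimately show "AE x in lebesgue_on {a<..<b}. (f has_vector_derivative g x) (at x)"
    proof eventually_elim
      fix x assume x: "x \<notin> N" "x \<in> {a<..<b}"
      show "(f has_vector_derivative g x) (at x)"
      proof (rule has_vector_derivative_transform_within_open[OF N(2)[OF x(1)]])
        show "open {a<..<b}" "x \<in> {a<..<b}" using x by auto
      qed (use ab in auto)
    qed
    have "(g has_integral (LINT x|lebesgue_on {a<..<b}. g x)) {a<..<b}"
      by (rule has_integral_integral_lebesgue_on[OF int]) auto
    then have "(g has_integral (LINT x|lebesgue_on {a<..<b}. g x)) {a..b}"
      by (simp add: has_integral_open_interval[of _ _ a b, simplified])
    then show "(LINT x|lebesgue_on {a<..<b}. g x) = f b - f a"
      using g(2)[of a b] ab by (auto dest: has_integral_unique)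
  qed
qed

section \<open>Cut-off functions\<close>

text \<open>Bounds the derivative of the cut-off by its slope constant, wherever that derivative
  exists, without computing it piece by piece.\<close>

lemma norm_vector_derivative_le_lipschitz:
  fixes f :: "real \<Rightarrow> 'a::real_normed_vector"
  assumes f: "(f has_vector_derivative D) (at x)"
    and S: "open S" "x \<in> S" and L: "\<And>y. y \<in> S \<Longrightarrow> norm (f y - f x) \<le> L * \<bar>y - x\<bar>"
  shows "norm D \<le> L"
proof -
  have lim: "((\<lambda>y. norm (f y - f x - (y - x) *\<^sub>R D) / norm (y - x)) \<longlongrightarrow> 0) (at x)"
    using f by (simp add: has_vector_derivative_def has_derivative_iff_norm)
  have "norm D - L \<le> 0"
  proof (rule tendsto_lowerbound[OF lim])
    have "\<forall>\<^sub>F y in at x. y \<in> S \<and> y \<noteq> x"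
      using S by (auto simp: eventually_at_filter intro: eventually_mono[OF eventually_nhds_in_open])
    then show "\<forall>\<^sub>F y in at x. norm D - L \<le> norm (f y - f x - (y - x) *\<^sub>R D) / norm (y - x)"
    proof eventually_elim
      fix y assume y: "y \<in> S \<and> y \<noteq> x"
      have "norm D * \<bar>y - x\<bar> - norm (f y - f x) \<le> norm (f y - f x - (y - x) *\<^sub>R D)"
        using norm_triangle_ineq2[of "(y - x) *\<^sub>R D" "f y - f x"]
        by (simp add: norm_minus_commute mult.commute)
      then have "(norm D - L) * \<bar>y - x\<bar> \<le> norm (f y - f x - (y - x) *\<^sub>R D)"
        using L[of y] y by (simp add: algebra_simps)
      then show "norm D - L \<le> norm (f y - f x - (y - x) *\<^sub>R D) / norm (y - x)"
        using y by (simp add: pos_le_divide_eq)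
    qed
  qed simp
  then show ?thesis by simp
qed

text \<open>A trapezoid supported on \<open>{l..r}\<close> with slopes \<open>1 / d\<close> and
  plateau 1. On intervals shorter than \<open>2 * d\<close> the same formula gives a triangle that
  stays below 1.\<close>

definition tent :: "real \<Rightarrow> real \<Rightarrow> real \<Rightarrow> real \<Rightarrow> real" where
  "tent d l r t = max 0 (min 1 (min (t - l) (r - t) / d))"

lemma tent_bounds: "0 \<le> tent d l r t" "tent d l r t \<le> 1"
  by (auto simp: tent_def)

lemma tent_eq_0:
  assumes "d > 0" "t \<le> l \<or> r \<le> t"
  shows "tent d l r t = 0"
proof -
  have "min (t - l) (r - t) / d \<le> 0" using assms by (intro divide_nonpos_pos) auto
  then show ?thesis by (auto simp: tent_def)
qed

lemma tent_lipschitz: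
  assumes "d > 0"
  shows "\<bar>tent d l r t - tent d l r u\<bar> \<le> (1 / d) * \<bar>t - u\<bar>"
proof -
  have "\<bar>tent d l r t - tent d l r u\<bar> \<le> \<bar>min (t - l) (r - t) / d - min (u - l) (r - u) / d\<bar>"
    by (auto simp: tent_def max_def min_def)
  also have "\<dots> = \<bar>min (t - l) (r - t) - min (u - l) (r - u)\<bar> / d"
    using assms by (simp add: diff_divide_distrib[symmetric])
  also have "\<dots> \<le> \<bar>t - u\<bar> / d"
    using assms by (intro divide_right_mono) (auto simp: min_def)
  finally show ?thesis by simp
qed

definition ramp :: "real \<Rightarrow> real \<Rightarrow> real" where
  "ramp d u = (if u \<in> {0..d} then 1 - u / d else 0)"

lemma ramp_nonneg: "d > 0 \<Longrightarrow> 0 \<le> ramp d u"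
  by (auto simp: ramp_def)

text \<open>The deficit is the larger of the deficits coming from the two ends. Bounding it by their
  sum also covers short intervals, where the ramps overlap.\<close>

lemma one_minus_tent_le:
  assumes "d > 0" "l < t" "t < r"
  shows "1 - tent d l r t \<le> ramp d (t - l) + ramp d (r - t)"
  using assms ramp_nonneg[OF assms(1)]
  by (auto simp: tent_def ramp_def min_def max_def field_simps)

lemma ramp_has_integral:
  assumes "d > 0"
  shows "((\<lambda>t. ramp d (t - c)) has_integral d / 2) UNIV"
    and "((\<lambda>t. ramp d (c - t)) has_integral d / 2) UNIV"
proof -
  have "((\<lambda>t. 1 - (t - c) / d) has_integral
      (((c + d) - (c + d - c)\<^sup>2 / (2 * d)) - (c - (c - c)\<^sup>2 / (2 * d)))) {c..c + d}"
    by (rule fundamental_theorem_of_calculus)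
      (use assms in \<open>auto intro!: derivative_eq_intros simp: has_real_derivative_iff_has_vector_derivative[symmetric] field_simps\<close>)
  also have "((c + d) - (c + d - c)\<^sup>2 / (2 * d)) - (c - (c - c)\<^sup>2 / (2 * d)) = d / 2"
    using assms by (simp add: power2_eq_square)
  finally have "((\<lambda>t. if t \<in> {c..c + d} then 1 - (t - c) / d else 0) has_integral d / 2) UNIV"
    by (simp only: has_integral_restrict_UNIV)
  moreover have "(\<lambda>t. if t \<in> {c..c + d} then 1 - (t - c) / d else 0) = (\<lambda>t. ramp d (t - c))"
    by (auto simp: ramp_def fun_eq_iff)
  ultimately show "((\<lambda>t. ramp d (t - c)) has_integral d / 2) UNIV" by simp
  have "((\<lambda>t. 1 - (c - t) / d) has_integral
      ((c + (c - c)\<^sup>2 / (2 * d)) - (c - d + (c - (c - d))\<^sup>2 / (2 * d)))) {c - d..c}"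
    by (rule fundamental_theorem_of_calculus)
      (use assms in \<open>auto intro!: derivative_eq_intros simp: has_real_derivative_iff_has_vector_derivative[symmetric] field_simps\<close>)
  also have "(c + (c - c)\<^sup>2 / (2 * d)) - (c - d + (c - (c - d))\<^sup>2 / (2 * d)) = d / 2"
    using assms by (simp add: power2_eq_square)
  finally have "((\<lambda>t. if t \<in> {c - d..c} then 1 - (c - t) / d else 0) has_integral d / 2) UNIV"
    by (simp only: has_integral_restrict_UNIV)
  moreover have "(\<lambda>t. if t \<in> {c - d..c} then 1 - (c - t) / d else 0) = (\<lambda>t. ramp d (c - t))"
    by (auto simp: ramp_def fun_eq_iff)
  ultimately show "((\<lambda>t. ramp d (c - t)) has_integral d / 2) UNIV" by simp
qed

lemma ramp_lebesgue_integral: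
  assumes "d > 0"
  shows "integrable (lebesgue_on {a<..<b}) (\<lambda>t. ramp d (t - c))"
    and "(LINT t|lebesgue_on {a<..<b}. ramp d (t - c)) \<le> d / 2"
    and "integrable (lebesgue_on {a<..<b}) (\<lambda>t. ramp d (c - t))"
    and "(LINT t|lebesgue_on {a<..<b}. ramp d (c - t)) \<le> d / 2"
proof -
  have *: "integrable (lebesgue_on {a<..<b}) h \<and> (LINT t|lebesgue_on {a<..<b}. h t) \<le> d / 2"
    if h: "(h has_integral d / 2) UNIV" and h0: "\<And>t. 0 \<le> h t" for h :: "real \<Rightarrow> real"
  proof -
    have "h absolutely_integrable_on UNIV"
      using h h0 by (intro nonnegative_absolutely_integrable_1) (auto simp: integrable_on_def)
    then have "h absolutely_integrable_on {a<..<b}"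
      by (rule set_integrable_subset) auto
    then have int: "integrable (lebesgue_on {a<..<b}) h"
      by (simp add: set_integrable_def integrable_restrict_space)
    have "(LINT t|lebesgue_on {a<..<b}. h t) = integral {a<..<b} h"
      by (rule lebesgue_integral_eq_integral[OF int]) auto
    also have "\<dots> \<le> integral UNIV h"
    proof (rule integral_subset_le)
      show "h integrable_on {a<..<b}"
        using has_integral_integral_lebesgue_on[OF int] by (auto simp: integrable_on_def)
    qed (use h h0 in \<open>auto simp: integrable_on_def\<close>)
    finally show ?thesis using int h by (simp add: integral_unique)
  qed
  show "integrable (lebesgue_on {a<..<b}) (\<lambda>t. ramp d (t - c))"
    "(LINT t|lebesgue_on {a<..<b}. ramp d (t - c)) \<le> d / 2"
    using *[OF ramp_has_integral(1)[OF assms]] ramp_nonneg[OF assms] by auto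
  show "integrable (lebesgue_on {a<..<b}) (\<lambda>t. ramp d (c - t))"
    "(LINT t|lebesgue_on {a<..<b}. ramp d (c - t)) \<le> d / 2"
    using *[OF ramp_has_integral(2)[OF assms]] ramp_nonneg[OF assms] by auto
qed

lemma ac_on_sum:
  assumes "\<And>i. i \<in> I \<Longrightarrow> ac_on a b (f i)"
  shows "ac_on a b (\<lambda>x. \<Sum>i\<in>I. f i x)"
proof (cases "finite I")
  case True
  then show ?thesis using assms
  proof (induction I)
    case empty
    show ?case by (simp, rule ac_on_lipschitz[of 0]) auto
  next
    case (insert i I)
    then show ?case by (simp add: ac_on_add)
  qed
next
  case False
  then show ?thesis by (simp, intro ac_on_lipschitz[of 0]) auto
qed

text \<open>Between consecutive turning points \<open>g\<close> is the sign of \<open>w\<close>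
  times a tent, so the pieces vanish where they meet and glue without a jump. The slope bound
  quantifies over every derivative \<open>D\<close>, because the actual derivative is supplied later
  by \<open>ac_on_fundamental\<close>.\<close>

lemma turning_point_cutoff:
  assumes ab: "a < b" and tp: "has_turning_points a b w n"
    and w0: "AE x in lebesgue_on {a<..<b}. w x \<noteq> 0" and d: "d > 0"
  obtains g :: "real \<Rightarrow> real" where "ac_on a b g" "g a = 0" "g b = 0"
    "AE t in lebesgue_on {a<..<b}. \<bar>g t\<bar> \<le> 1 \<and> g t * w t = \<bar>g t\<bar> * \<bar>w t\<bar> \<and>
       (\<forall>D. ((\<lambda>x. complex_of_real (g x)) has_vector_derivative D) (at t) \<longrightarrow> norm D \<le> 1 / d)"
    "(LINT t|lebesgue_on {a<..<b}. 1 - \<bar>g t\<bar>) \<le> (real n + 1) * d"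
proof -
  obtain x s :: "nat \<Rightarrow> real" where x0: "x 0 = a" and xn: "x (n + 1) = b"
    and xx: "\<And>k. k \<le> n \<Longrightarrow> x k < x (k + 1)"
    and sg: "\<And>k. k \<le> n \<Longrightarrow> AE t in lebesgue_on {x k<..<x (k + 1)}. sgn (w t) = s k"
    using tp unfolding has_turning_points_def by blast
  have mono: "x i \<le> x j" if "i \<le> j" "j \<le> n + 1" for i j
    using that
  proof (induction j rule: dec_induct)
    case (step m)
    then show ?case using xx[of m] by simp
  qed simp
  define M where "M = lebesgue_on {a<..<b}"
  define g where "g t = (\<Sum>k\<le>n. s k * tent d (x k) (x (k + 1)) t)" for t
  \<comment> \<open>The tents are nonzero only on pairwise disjoint intervals, so a single summand
    survives at each point.\<close>
  have g_eq: "g t = s k * tent d (x k) (x (k + 1)) t" if "k \<le> n" "t \<in> {x k<..<x (k + 1)}" for k t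
  proof -
    have "s j * tent d (x j) (x (j + 1)) t = 0" if "j \<le> n" "j \<noteq> k" for j
    proof (cases "j < k")
      case True
      then have "x (j + 1) \<le> x k" using \<open>k \<le> n\<close> by (intro mono) auto
      then show ?thesis using \<open>t \<in> _\<close> by (simp add: tent_eq_0[OF d])
    next
      case False
      then have "x (k + 1) \<le> x j" using that by (intro mono) auto
      then show ?thesis using \<open>t \<in> _\<close> by (simp add: tent_eq_0[OF d])
    qed
    then have "(\<Sum>j\<in>{..n} - {k}. s j * tent d (x j) (x (j + 1)) t) = 0" by (intro sum.neutral) auto
    then show ?thesis unfolding g_def using \<open>k \<le> n\<close> by (subst sum.remove[of _ k]) auto
  qed
  have cover: "\<exists>k\<le>n. t \<in> {x k<..<x (k + 1)}" if "t \<in> {a<..<b}" "t \<notin> x ` {..n + 1}" for t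
  proof -
    have "\<exists>k<m. t \<in> {x k<..<x (k + 1)}" if "t < x m" "m \<le> n + 1" for m
      using that
    proof (induction m)
      case 0
      then show ?case using x0 \<open>t \<in> {a<..<b}\<close> by simp
    next
      case (Suc m)
      show ?case
      proof (cases "t < x m")
        case True
        then show ?thesis using Suc by (metis Suc_leD less_Suc_eq)
      next
        case False
        moreover have "t \<noteq> x m" using \<open>t \<notin> x ` {..n + 1}\<close> Suc.prems by auto
        ultimately show ?thesis using Suc.prems by (intro exI[of _ m]) auto
      qed
    qed
    from this[of "n + 1"] show ?thesis using that xn by (auto simp: less_Suc_eq_le)
  qed
  have AEM: "(AE t in M. P t) \<longleftrightarrow> (AE t in lebesgue. t \<in> {a<..<b} \<longrightarrow> P t)" for P
    unfolding M_def by (rule AE_restrict_space_iff) auto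
  have "AE t in M. \<forall>k\<in>{..n}. t \<in> {x k<..<x (k + 1)} \<longrightarrow> sgn (w t) = s k"
  proof (rule AE_finite_allI)
    fix k assume "k \<in> {..n}"
    then have "AE t in lebesgue. t \<in> {x k<..<x (k + 1)} \<longrightarrow> sgn (w t) = s k"
      using sg[of k] by (simp add: AE_restrict_space_iff)
    then show "AE t in M. t \<in> {x k<..<x (k + 1)} \<longrightarrow> sgn (w t) = s k"
      unfolding AEM by eventually_elim auto
  qed simp
  moreover have "AE t in M. t \<notin> x ` {..n + 1}"
  proof -
    have "negligible (x ` {..n + 1})" by (intro negligible_finite) auto
    then have "AE t in lebesgue. t \<notin> x ` {..n + 1}" by (simp add: negligible_iff_null_sets AE_not_in)
    then show ?thesis unfolding AEM by eventually_elim auto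
  qed
  moreover have "AE t in M. w t \<noteq> 0" unfolding M_def by (rule w0)
  moreover have "AE t in M. t \<in> {a<..<b}" unfolding AEM by auto
  \<comment> \<open>The value \<open>\<bar>s k\<bar> = 1\<close> is read off at the point itself,
    where \<open>w t \<noteq> 0\<close>; the definition of turning points would also permit the sign
    0.\<close>
  ultimately have main: "AE t in M. \<exists>k\<le>n. t \<in> {x k<..<x (k + 1)} \<and> sgn (w t) = s k \<and> \<bar>s k\<bar> = 1"
  proof eventually_elim
    fix t assume t: "\<forall>k\<in>{..n}. t \<in> {x k<..<x (k + 1)} \<longrightarrow> sgn (w t) = s k" "t \<notin> x ` {..n + 1}"
      "w t \<noteq> 0" "t \<in> {a<..<b}"
    obtain k where k: "k \<le> n" "t \<in> {x k<..<x (k + 1)}" using cover t by blast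
    then have "sgn (w t) = s k" using t(1) by auto
    moreover from this have "\<bar>s k\<bar> = 1" using t(3) by (metis abs_sgn_eq_1)
    ultimately show "\<exists>k\<le>n. t \<in> {x k<..<x (k + 1)} \<and> sgn (w t) = s k \<and> \<bar>s k\<bar> = 1"
      using k by blast
  qed
  have acg: "ac_on a b g"
  proof -
    have "ac_on a b (\<lambda>t. s k * tent d (x k) (x (k + 1)) t)" for k
    proof (rule ac_on_lipschitz)
      show "0 \<le> \<bar>s k\<bar> * (1 / d)" using d by simp
      fix t u :: real assume "t \<le> u"
      have "norm (s k * tent d (x k) (x (k + 1)) u - s k * tent d (x k) (x (k + 1)) t)
        = \<bar>s k\<bar> * \<bar>tent d (x k) (x (k + 1)) u - tent d (x k) (x (k + 1)) t\<bar>"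
        by (simp add: abs_mult[symmetric] right_diff_distrib)
      also have "\<dots> \<le> \<bar>s k\<bar> * ((1 / d) * \<bar>u - t\<bar>)"
        by (intro mult_left_mono tent_lipschitz d) simp
      finally show "norm (s k * tent d (x k) (x (k + 1)) u - s k * tent d (x k) (x (k + 1)) t)
          \<le> \<bar>s k\<bar> * (1 / d) * (u - t)" using \<open>t \<le> u\<close> by simp
    qed
    then show ?thesis unfolding g_def by (rule ac_on_sum)
  qed
  show thesis
  proof (rule that[OF acg])
    show "g a = 0"
      unfolding g_def using mono[of 0] x0 by (intro sum.neutral) (auto simp: tent_eq_0[OF d])
    show "g b = 0"
      unfolding g_def using mono[of _ "n + 1"] xn by (intro sum.neutral) (auto simp: tent_eq_0[OF d])
    have "AE t in M. \<bar>g t\<bar> \<le> 1 \<and> g t * w t = \<bar>g t\<bar> * \<bar>w t\<bar> \<and>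
       (\<forall>D. ((\<lambda>x. complex_of_real (g x)) has_vector_derivative D) (at t) \<longrightarrow> norm D \<le> 1 / d)"
      using main
    proof eventually_elim
      fix t assume "\<exists>k\<le>n. t \<in> {x k<..<x (k + 1)} \<and> sgn (w t) = s k \<and> \<bar>s k\<bar> = 1"
      then obtain k where k: "k \<le> n" "t \<in> {x k<..<x (k + 1)}" "sgn (w t) = s k" "\<bar>s k\<bar> = 1" by blast
      define T where "T = tent d (x k) (x (k + 1))"
      have gt: "g u = s k * T u" if "u \<in> {x k<..<x (k + 1)}" for u
        using g_eq[OF k(1) that] by (simp add: T_def)
      have T: "0 \<le> T u" "T u \<le> 1" for u by (simp_all add: T_def tent_bounds)
      have ag: "\<bar>g t\<bar> = T t" using gt[OF k(2)] k(4) T by (simp add: abs_mult)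
      have "g t * w t = T t * (sgn (w t) * w t)" using gt[OF k(2)] k(3) by simp
      also have "sgn (w t) * w t = \<bar>w t\<bar>" by (simp add: sgn_real_def abs_if)
      finally have gw: "g t * w t = \<bar>g t\<bar> * \<bar>w t\<bar>" using ag by simp
      have "norm D \<le> 1 / d"
        if D: "((\<lambda>x. complex_of_real (g x)) has_vector_derivative D) (at t)" for D
      proof (rule norm_vector_derivative_le_lipschitz[OF D])
        show "open {x k<..<x (k + 1)}" by simp
        fix u assume u: "u \<in> {x k<..<x (k + 1)}"
        have "norm (complex_of_real (g u) - complex_of_real (g t)) = \<bar>g u - g t\<bar>"
          by (metis norm_of_real of_real_diff)
        also have "\<dots> = \<bar>s k\<bar> * \<bar>T u - T t\<bar>"
          using gt[OF k(2)] gt[OF u] by (simp add: abs_mult[symmetric] right_diff_distrib)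
        also have "\<dots> \<le> (1 / d) * \<bar>u - t\<bar>" using k(4) tent_lipschitz[OF d] by (simp add: T_def)
        finally show "norm (complex_of_real (g u) - complex_of_real (g t)) \<le> (1 / d) * \<bar>u - t\<bar>" .
      qed (rule k(2))
      then show "\<bar>g t\<bar> \<le> 1 \<and> g t * w t = \<bar>g t\<bar> * \<bar>w t\<bar> \<and>
        (\<forall>D. ((\<lambda>x. complex_of_real (g x)) has_vector_derivative D) (at t) \<longrightarrow> norm D \<le> 1 / d)"
        using ag gw T by simp
    qed
    then show "AE t in lebesgue_on {a<..<b}. \<bar>g t\<bar> \<le> 1 \<and> g t * w t = \<bar>g t\<bar> * \<bar>w t\<bar> \<and>
       (\<forall>D. ((\<lambda>x. complex_of_real (g x)) has_vector_derivative D) (at t) \<longrightarrow> norm D \<le> 1 / d)"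
      unfolding M_def .
    \<comment> \<open>All ramps of all intervals at once: n + 1 intervals with two ends each, every
      ramp with integral at most \<open>d / 2\<close>.\<close>
    define R where "R t = (\<Sum>k\<le>n. ramp d (t - x k) + ramp d (x (k + 1) - t))" for t
    have Rint: "integrable M R"
      unfolding R_def M_def by (intro Bochner_Integration.integrable_sum Bochner_Integration.integrable_add ramp_lebesgue_integral d)
    have le: "AE t in M. 1 - \<bar>g t\<bar> \<le> R t"
      using main
    proof eventually_elim
      fix t assume "\<exists>k\<le>n. t \<in> {x k<..<x (k + 1)} \<and> sgn (w t) = s k \<and> \<bar>s k\<bar> = 1"
      then obtain k where k: "k \<le> n" "t \<in> {x k<..<x (k + 1)}" "sgn (w t) = s k" "\<bar>s k\<bar> = 1" by blast
      have "1 - \<bar>g t\<bar> = 1 - tent d (x k) (x (k + 1)) t"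
        using g_eq[OF k(1,2)] k(4) by (simp add: abs_mult tent_bounds)
      also have "\<dots> \<le> ramp d (t - x k) + ramp d (x (k + 1) - t)"
        by (rule one_minus_tent_le) (use k d in auto)
      also have "\<dots> \<le> R t"
        unfolding R_def by (rule member_le_sum) (use k ramp_nonneg[OF d] in auto)
      finally show "1 - \<bar>g t\<bar> \<le> R t" .
    qed
    have "(LINT t|M. 1 - \<bar>g t\<bar>) \<le> (LINT t|M. R t)"
    proof (rule integral_mono_AE')
      show "AE t in M. 0 \<le> R t"
        unfolding R_def by (intro AE_I2 sum_nonneg add_nonneg_nonneg ramp_nonneg d)
    qed (use Rint le in auto)
    also have "\<dots> = (\<Sum>k\<le>n. (LINT t|M. ramp d (t - x k)) + (LINT t|M. ramp d (x (k + 1) - t)))"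
      unfolding R_def M_def
      by (subst Bochner_Integration.integral_sum)
        (auto simp: ramp_lebesgue_integral[OF d])
    also have "\<dots> \<le> (\<Sum>k\<le>n. d / 2 + d / 2)"
      unfolding M_def by (intro sum_mono add_mono ramp_lebesgue_integral d)
    also have "\<dots> = (real n + 1) * d" by simp
    finally show "(LINT t|lebesgue_on {a<..<b}. 1 - \<bar>g t\<bar>) \<le> (real n + 1) * d" by (simp add: M_def)
  qed
qed

section \<open>Eigenfunctions\<close>

text \<open>The integral of \<open>(u - t * v)\<^sup>2\<close> is a nonnegative quadratic in
  \<open>t\<close>, evaluated at its minimizer \<open>B / C\<close> when \<open>C\<close> is
  positive.\<close>

lemma integral_Cauchy_Schwarz:
  fixes u v :: "'a \<Rightarrow> real"
  assumes uu: "integrable M (\<lambda>x. (u x)\<^sup>2)" and vv: "integrable M (\<lambda>x. (v x)\<^sup>2)"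
    and uv: "integrable M (\<lambda>x. u x * v x)"
  shows "(LINT x|M. u x * v x)\<^sup>2 \<le> (LINT x|M. (u x)\<^sup>2) * (LINT x|M. (v x)\<^sup>2)"
proof -
  define A B C where "A = (LINT x|M. (u x)\<^sup>2)" and "B = (LINT x|M. u x * v x)"
    and "C = (LINT x|M. (v x)\<^sup>2)"
  have q: "0 \<le> A - 2 * t * B + t\<^sup>2 * C" for t
  proof -
    have "0 \<le> (LINT x|M. (u x - t * v x)\<^sup>2)" by (rule Bochner_Integration.integral_nonneg) simp
    also have "(\<lambda>x. (u x - t * v x)\<^sup>2) = (\<lambda>x. (u x)\<^sup>2 - 2 * t * (u x * v x) + t\<^sup>2 * (v x)\<^sup>2)"
      by (auto simp: power2_eq_square algebra_simps)
    also have "(LINT x|M. (u x)\<^sup>2 - 2 * t * (u x * v x) + t\<^sup>2 * (v x)\<^sup>2) = A - 2 * t * B + t\<^sup>2 * C"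
      using uu vv uv by (simp add: A_def B_def C_def)
    finally show ?thesis .
  qed
  have "C \<ge> 0" unfolding C_def by (rule Bochner_Integration.integral_nonneg) simp
  have "B\<^sup>2 \<le> A * C"
  proof (cases "C = 0")
    case True
    have "B = 0"
    proof (rule ccontr)
      assume "B \<noteq> 0"
      \<comment> \<open>For \<open>C = 0\<close> the quadratic degenerates to
        \<open>A - 2 * t * B\<close>, which equals -1 at this \<open>t\<close>.\<close>
      then show False using q[of "(A + 1) / (2 * B)"] True by simp
    qed
    then show ?thesis using True by simp
  next
    case False
    then have "C > 0" using \<open>C \<ge> 0\<close> by simp
    then have "0 \<le> (A - 2 * (B / C) * B + (B / C)\<^sup>2 * C) * C"
      using q[of "B / C"] by (intro mult_nonneg_nonneg) auto
    also have "\<dots> = A * C - B\<^sup>2" using \<open>C > 0\<close> by (simp add: field_simps power2_eq_square)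
    finally show ?thesis by simp
  qed
  then show ?thesis by (simp add: A_def B_def C_def)
qed

lemma integrable_continuous_mult:
  fixes c k :: "real \<Rightarrow> 'a::{euclidean_space, real_normed_field}"
  assumes c: "continuous_on {a..b} c" and k: "integrable (lebesgue_on {a<..<b}) k"
  shows "integrable (lebesgue_on {a<..<b}) (\<lambda>x. c x * k x)"
proof -
  have "bounded (c ` {a..b})" by (intro compact_imp_bounded compact_continuous_image c) auto
  then obtain C where C: "\<forall>y\<in>c ` {a..b}. norm y \<le> C" unfolding bounded_iff by blast
  have cm: "c \<in> borel_measurable (lebesgue_on {a<..<b})"
    by (rule continuous_imp_measurable_on_sets_lebesgue[OF continuous_on_subset[OF c]]) auto
  show ?thesis
  proof (rule Bochner_Integration.integrable_bound)
    show "integrable (lebesgue_on {a<..<b}) (\<lambda>x. C * norm (k x))" using k by simp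
    show "(\<lambda>x. c x * k x) \<in> borel_measurable (lebesgue_on {a<..<b})"
      using cm borel_measurable_integrable[OF k] by simp
    show "AE x in lebesgue_on {a<..<b}. norm (c x * k x) \<le> norm (C * norm (k x))"
    proof (rule AE_I2)
      fix x assume "x \<in> space (lebesgue_on {a<..<b})"
      then have x: "x \<in> {a..b}" by auto
      then have "norm (c x) \<le> C" using C by blast
      then show "norm (c x * k x) \<le> norm (C * norm (k x))"
        using norm_ge_zero[of "c x"] by (simp add: norm_mult abs_mult mult_right_mono)
    qed
  qed
qed

lemma integrable_lebesgue_on_const:
  "integrable (lebesgue_on {a<..<b::real}) (\<lambda>x. c::'a::{banach, second_countable_topology})"
proof -
  have "emeasure (lebesgue_on {a<..<b}) (space (lebesgue_on {a<..<b})) = emeasure lborel {a<..<b}"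
    by (subst emeasure_restrict_space) auto
  also have "\<dots> < \<infinity>" by (cases "a \<le> b") auto
  finally have "finite_measure (lebesgue_on {a<..<b})" by (intro finite_measureI) auto
  then show ?thesis by (intro finite_measure.integrable_const)
qed

lemma measure_lebesgue_on_interval:
  "a \<le> b \<Longrightarrow> measure (lebesgue_on {a<..<b::real}) {a<..<b} = b - a"
  by (subst measure_restrict_space) auto

lemma integrable_lebesgue_on_continuous:
  fixes c :: "real \<Rightarrow> 'a::{euclidean_space, real_normed_field}"
  assumes c: "continuous_on {a..b} c"
  shows "integrable (lebesgue_on {a<..<b}) c"
  using integrable_continuous_mult[OF c integrable_lebesgue_on_const[of a b 1]] by simp

text \<open>The eigenvalue equation as a first-order system with \<open>p\<close> the derivative of
  \<open>f\<close>. Boundary conditions are left out; they enter the estimates only through the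
  boundary form at \<open>a\<close> and \<open>b\<close>.\<close>

locale eigenfunction =
  fixes a b :: real and q w :: "real \<Rightarrow> real" and z :: complex and f p :: "real \<Rightarrow> complex"
  assumes ab: "a < b"
    and q: "integrable (lebesgue_on {a<..<b}) q"
    and w: "integrable (lebesgue_on {a<..<b}) w"
    and f_deriv: "\<And>x. x \<in> {a..b} \<Longrightarrow> (f has_vector_derivative p x) (at x within {a..b})"
    and ac_f: "ac_on a b f" and ac_p: "ac_on a b p"
    and eq: "AE x in lebesgue_on {a<..<b}.
       (p has_vector_derivative (of_real (q x) - z * of_real (w x)) * f x) (at x)"
begin

abbreviation "M \<equiv> lebesgue_on {a<..<b}"

definition "mass = (LINT x|M. (norm (f x))\<^sup>2)"
definition "energy = (LINT x|M. (norm (p x))\<^sup>2)"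
text \<open>This one quantity controls both the oscillation of |f|^2 and the error caused by the
  ramps.\<close>

definition "cross = (LINT x|M. norm (f x) * norm (p x))"

lemma cont_f [continuous_intros]: "continuous_on {a..b} f"
  by (rule ac_on_imp_continuous_on[OF ac_f])
lemma cont_p [continuous_intros]: "continuous_on {a..b} p"
  by (rule ac_on_imp_continuous_on[OF ac_p])

lemma integrable_sqs:
  "integrable M (\<lambda>x. (norm (f x))\<^sup>2)" "integrable M (\<lambda>x. (norm (p x))\<^sup>2)"
  "integrable M (\<lambda>x. norm (f x) * norm (p x))"
  by (intro integrable_lebesgue_on_continuous continuous_intros)+

lemma nonneg: "0 \<le> mass" "0 \<le> energy" "0 \<le> cross"
  unfolding mass_def energy_def cross_def by (rule Bochner_Integration.integral_nonneg; simp)+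

lemma cross_le: "cross \<le> sqrt mass * sqrt energy"
proof -
  have "cross\<^sup>2 \<le> mass * energy"
    using integral_Cauchy_Schwarz[OF integrable_sqs] by (simp add: cross_def mass_def energy_def)
  then show ?thesis using nonneg by (metis real_le_rsqrt real_sqrt_mult)
qed

text \<open>The equation multiplied by \<open>g * cnj f\<close> and integrated by parts. Every
  integral except the one with \<open>gd\<close> is real, so real and imaginary parts can be
  compared afterwards.\<close>

lemma weak_form:
  fixes g :: "real \<Rightarrow> real" and gd :: "real \<Rightarrow> complex"
  assumes g: "ac_on a b g" and gd: "integrable M gd"
    and gder: "AE x in M. ((\<lambda>x. complex_of_real (g x)) has_vector_derivative gd x) (at x)"
  shows "(LINT x|M. (p x * cnj (f x)) * gd x) + of_real (LINT x|M. (g x * (norm (f x))\<^sup>2) * q x)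
      - z * of_real (LINT x|M. (g x * (norm (f x))\<^sup>2) * w x)
      + of_real (LINT x|M. g x * (norm (p x))\<^sup>2) =
      of_real (g b) * (p b * cnj (f b)) - of_real (g a) * (p a * cnj (f a))"
proof -
  have cg[continuous_intros]: "continuous_on {a..b} g" by (rule ac_on_imp_continuous_on[OF g])
  have acg: "ac_on a b (\<lambda>x. complex_of_real (g x))"
    by (rule ac_on_bounded_linear[OF bounded_linear_of_real g])
  have "ac_on a b (\<lambda>x. cnj (f x))" by (rule ac_on_bounded_linear[OF bounded_linear_cnj ac_f])
  then have "ac_on a b (\<lambda>x. of_real (g x) * (p x * cnj (f x)))"
    by (intro ac_on_mult acg ac_p)
  from ac_on_fundamental[OF ab this] obtain k where k: "integrable M k"
    "AE x in M. ((\<lambda>x. of_real (g x) * (p x * cnj (f x))) has_vector_derivative k x) (at x)"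
    "(LINT x|M. k x) = of_real (g b) * (p b * cnj (f b)) - of_real (g a) * (p a * cnj (f a))"
    by blast
  define h1 where "h1 x = (p x * cnj (f x)) * gd x" for x
  define h2 where "h2 x = complex_of_real ((g x * (norm (f x))\<^sup>2) * q x)" for x
  define h3 where "h3 x = z * complex_of_real ((g x * (norm (f x))\<^sup>2) * w x)" for x
  define h4 where "h4 x = complex_of_real (g x * (norm (p x))\<^sup>2)" for x
  have i1: "integrable M h1" unfolding h1_def
    by (intro integrable_continuous_mult gd continuous_intros)
  have i2: "integrable M h2" unfolding h2_def
    by (intro integrable_of_real integrable_continuous_mult q continuous_intros)
  have i3: "integrable M h3" unfolding h3_def
    by (intro integrable_mult_right integrable_of_real integrable_continuous_mult w continuous_intros)
  have i4: "integrable M h4" unfolding h4_def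
    by (intro integrable_of_real integrable_lebesgue_on_continuous continuous_intros)
  have "AE x in M. x \<in> {a<..<b}" by (rule AE_I2) auto
  \<comment> \<open>\<open>k\<close> is merely some almost everywhere derivative of the product. The
    product rule computes another one, and uniqueness of derivatives identifies the two.\<close>
  with k(2) gder eq have "AE x in M. k x = h1 x + h2 x - h3 x + h4 x"
  proof eventually_elim
    fix x assume x: "x \<in> {a<..<b}"
      and 1: "((\<lambda>x. of_real (g x) * (p x * cnj (f x))) has_vector_derivative k x) (at x)"
      and 2: "((\<lambda>x. complex_of_real (g x)) has_vector_derivative gd x) (at x)"
      and 3: "(p has_vector_derivative (of_real (q x) - z * of_real (w x)) * f x) (at x)"
    have "(f has_vector_derivative p x) (at x)"
      using f_deriv[of x] x at_within_Icc_at[of a x b] by auto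
    then have 4: "((\<lambda>x. cnj (f x)) has_vector_derivative cnj (p x)) (at x)"
      by (rule has_vector_derivative_cnj)
    have "((\<lambda>x. of_real (g x) * (p x * cnj (f x))) has_vector_derivative
      of_real (g x) * (p x * cnj (p x) + (of_real (q x) - z * of_real (w x)) * f x * cnj (f x))
       + gd x * (p x * cnj (f x))) (at x)"
      by (intro has_vector_derivative_mult 2 3 4)
    then have "k x = of_real (g x) * (p x * cnj (p x) + (of_real (q x) - z * of_real (w x)) * f x * cnj (f x))
       + gd x * (p x * cnj (f x))"
      using 1 vector_derivative_unique_at by blast
    also have "\<dots> = h1 x + h2 x - h3 x + h4 x"
    proof -
      have n: "complex_of_real ((norm y)\<^sup>2) = y * cnj y" for y by (rule complex_norm_square)
      show ?thesis unfolding h1_def h2_def h3_def h4_def of_real_mult n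
        by (simp add: algebra_simps)
    qed
    finally show "k x = h1 x + h2 x - h3 x + h4 x" .
  qed
  then have "(LINT x|M. k x) = (LINT x|M. h1 x + h2 x - h3 x + h4 x)"
    by (intro integral_cong_AE) (use k(1) i1 i2 i3 i4 in \<open>auto intro: borel_measurable_integrable\<close>)
  also have "\<dots> = (LINT x|M. h1 x) + (LINT x|M. h2 x) - (LINT x|M. h3 x) + (LINT x|M. h4 x)"
    using i1 i2 i3 i4 by simp
  also have "(LINT x|M. h2 x) = of_real (LINT x|M. (g x * (norm (f x))\<^sup>2) * q x)"
    unfolding h2_def by (rule integral_complex_of_real)
  also have "(LINT x|M. h3 x) = z * of_real (LINT x|M. (g x * (norm (f x))\<^sup>2) * w x)"
    unfolding h3_def by (simp only: integral_mult_right_zero integral_complex_of_real)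
  also have "(LINT x|M. h4 x) = of_real (LINT x|M. g x * (norm (p x))\<^sup>2)"
    unfolding h4_def by (rule integral_complex_of_real)
  finally show ?thesis unfolding k(3) h1_def by simp
qed

section \<open>A priori estimates for eigenfunctions\<close>

lemma energy_identity:
  "of_real (LINT x|M. (norm (f x))\<^sup>2 * q x) - z * of_real (LINT x|M. (norm (f x))\<^sup>2 * w x)
     + of_real energy = p b * cnj (f b) - p a * cnj (f a)"
proof -
  have "ac_on a b (\<lambda>_. 1 :: real)" by (rule ac_on_lipschitz[of 0]) auto
  from weak_form[OF this, of "\<lambda>_. 0"] show ?thesis by (simp add: energy_def)
qed

text \<open>The derivative of |f|^2 is 2 Re (p cnj f), so |f|^2 varies by at most twice the integral
  of |f| |p|.\<close>

lemma norm_sq_le_cross: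
  assumes "x \<in> {a..b}" "y \<in> {a..b}"
  shows "(norm (f x))\<^sup>2 \<le> (norm (f y))\<^sup>2 + 2 * cross"
proof -
  define k where "k t = 2 * Re (p t * cnj (f t))" for t
  have int: "integral {a..b} (\<lambda>t. norm (f t) * norm (p t)) = cross"
  proof -
    have "cross = integral {a<..<b} (\<lambda>t. norm (f t) * norm (p t))"
      unfolding cross_def by (rule lebesgue_integral_eq_integral[OF integrable_sqs(3)]) auto
    then show ?thesis by (simp add: integral_open_interval_real)
  qed
  have *: "\<bar>(norm (f v))\<^sup>2 - (norm (f u))\<^sup>2\<bar> \<le> 2 * cross" if uv: "u \<in> {a..b}" "v \<in> {a..b}" "u \<le> v" for u v
  proof -
    have sub: "{u..v} \<subseteq> {a..b}" using uv by auto
    have "(k has_integral ((norm (f v))\<^sup>2 - (norm (f u))\<^sup>2)) {u..v}"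
    proof (rule fundamental_theorem_of_calculus[OF uv(3)])
      fix t assume t: "t \<in> {u..v}"
      have 1: "(f has_vector_derivative p t) (at t within {u..v})"
        using f_deriv[of t] t sub by (meson has_vector_derivative_within_subset subsetD)
      have "((\<lambda>t. Re (f t * cnj (f t))) has_vector_derivative Re (f t * cnj (p t) + p t * cnj (f t)))
          (at t within {u..v})"
        by (intro bounded_linear.has_vector_derivative[OF bounded_linear_Re]
          has_vector_derivative_mult has_vector_derivative_cnj 1)
      moreover have "Re (f t * cnj (p t) + p t * cnj (f t)) = k t" by (simp add: k_def)
      moreover have "Re (f t * cnj (f t)) = (norm (f t))\<^sup>2" for t
        by (simp only: complex_norm_square[symmetric] Re_complex_of_real)
      ultimately show "((\<lambda>t. (norm (f t))\<^sup>2) has_vector_derivative k t) (at t within {u..v})" by simp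
    qed
    then have k: "k integrable_on {u..v}" "integral {u..v} k = (norm (f v))\<^sup>2 - (norm (f u))\<^sup>2"
      by (auto simp: integrable_on_def integral_unique)
    have cont: "continuous_on {a..b} (\<lambda>t. 2 * (norm (f t) * norm (p t)))"
      by (intro continuous_intros)
    have "norm (integral {u..v} k) \<le> integral {u..v} (\<lambda>t. 2 * (norm (f t) * norm (p t)))"
    proof (rule integral_norm_bound_integral[OF k(1)])
      show "(\<lambda>t. 2 * (norm (f t) * norm (p t))) integrable_on {u..v}"
        using continuous_on_subset[OF cont sub] by (rule integrable_continuous_real)
      show "norm (k t) \<le> 2 * (norm (f t) * norm (p t))" for t
        using abs_Re_le_cmod[of "p t * cnj (f t)"] by (simp add: k_def norm_mult mult.commute)
    qed
    also have "\<dots> \<le> integral {a..b} (\<lambda>t. 2 * (norm (f t) * norm (p t)))"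
    proof (rule integral_subset_le[OF sub])
      show "(\<lambda>t. 2 * (norm (f t) * norm (p t))) integrable_on {u..v}"
        using continuous_on_subset[OF cont sub] by (rule integrable_continuous_real)
      show "(\<lambda>t. 2 * (norm (f t) * norm (p t))) integrable_on {a..b}"
        using cont by (rule integrable_continuous_real)
    qed simp
    also have "\<dots> = 2 * cross" using int by simp
    finally show ?thesis by (simp add: k(2))
  qed
  show ?thesis
    using *[of x y] *[of y x] assms by (cases "x \<le> y") auto
qed

text \<open>The previous bound is averaged over \<open>y\<close>, which turns the value at
  \<open>y\<close> into \<open>mass / (b - a)\<close>.\<close>

lemma norm_sq_le:
  assumes x: "x \<in> {a..b}"
  shows "(norm (f x))\<^sup>2 \<le> mass / (b - a) + 2 * (sqrt mass * sqrt energy)"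
proof -
  have "(b - a) * (norm (f x))\<^sup>2 = (LINT y|M. (norm (f x))\<^sup>2)"
    using ab by (simp add: measure_lebesgue_on_interval)
  also have "\<dots> \<le> (LINT y|M. (norm (f y))\<^sup>2 + 2 * cross)"
    by (rule integral_mono)
      (use norm_sq_le_cross[OF x] in \<open>auto intro!: Bochner_Integration.integrable_add integrable_sqs integrable_lebesgue_on_const\<close>)
  also have "\<dots> = mass + (LINT y|M. 2 * cross)"
    unfolding mass_def by (rule Bochner_Integration.integral_add[OF integrable_sqs(1) integrable_lebesgue_on_const])
  also have "(LINT y|M. 2 * cross) = (b - a) * (2 * cross)"
    using ab by (simp add: measure_lebesgue_on_interval)
  finally have "(norm (f x))\<^sup>2 \<le> mass / (b - a) + 2 * cross"
    using ab by (simp add: field_simps)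
  then show ?thesis using cross_le by simp
qed

text \<open>The boundary condition is abstracted to a real boundary form \<open>r\<close> with a
  bound linear in \<open>S\<close>. The bound is assumed for every admissible \<open>S\<close>, so
  that it can be used with the maximum of |f|^2.\<close>

lemma a_priori:
  assumes bd: "p b * cnj (f b) - p a * cnj (f a) = of_real r"
    and bdle: "\<And>S. (norm (f a))\<^sup>2 \<le> S \<Longrightarrow> (norm (f b))\<^sup>2 \<le> S \<Longrightarrow> \<bar>r\<bar> \<le> c * S"
    and \<alpha>: "\<alpha> = c + L1_norm a b (\<lambda>x. min 0 (q x))" "\<alpha> \<ge> 0"
    and \<beta>: "\<beta> = sqrt (\<alpha> * (1 / (b - a) + \<alpha>)) + \<alpha>"
    and \<gamma>: "\<gamma> = sqrt (2 * \<beta> + 1 / (b - a))"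
    and z: "Im z \<noteq> 0"
  shows "sqrt energy \<le> \<beta> * sqrt mass"
    and "\<And>x. x \<in> {a..b} \<Longrightarrow> (norm (f x))\<^sup>2 \<le> \<gamma>\<^sup>2 * mass"
proof -
  define Q where "Q = (LINT x|M. (norm (f x))\<^sup>2 * q x)"
  define W where "W = (LINT x|M. (norm (f x))\<^sup>2 * w x)"
  have id: "of_real Q - z * of_real W + of_real energy = complex_of_real r"
    using energy_identity unfolding bd Q_def W_def .
  \<comment> \<open>\<open>Q\<close>, \<open>W\<close>, \<open>energy\<close> and \<open>r\<close>
    are real, so the imaginary part reduces to \<open>Im z * W = 0\<close>.\<close>
  from arg_cong[OF id, of Im] have W: "W = 0" using z by simp
  from arg_cong[OF id, of Re] W have en: "energy = r - Q" by simp
  have "compact {a..b}" "{a..b} \<noteq> {}" using ab by auto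
  moreover have "continuous_on {a..b} (\<lambda>x. (norm (f x))\<^sup>2)" by (intro continuous_intros)
  ultimately have "\<exists>x\<in>{a..b}. \<forall>y\<in>{a..b}. (norm (f y))\<^sup>2 \<le> (norm (f x))\<^sup>2"
    by (rule continuous_attains_sup)
  then obtain x0 where x0: "x0 \<in> {a..b}" "\<And>x. x \<in> {a..b} \<Longrightarrow> (norm (f x))\<^sup>2 \<le> (norm (f x0))\<^sup>2"
    by blast
  define S where "S = (norm (f x0))\<^sup>2"
  have S0: "S \<ge> 0" by (simp add: S_def)
  have min_int: "integrable M (\<lambda>x. \<bar>min 0 (q x)\<bar>)"
    by (rule Bochner_Integration.integrable_bound[OF q])
      (use borel_measurable_integrable[OF q] in auto)
  have "- Q = (LINT x|M. - ((norm (f x))\<^sup>2 * q x))" by (simp add: Q_def)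
  also have "\<dots> \<le> (LINT x|M. S * \<bar>min 0 (q x)\<bar>)"
  proof (rule integral_mono)
    show "integrable M (\<lambda>x. - ((norm (f x))\<^sup>2 * q x))"
      by (intro integrable_minus integrable_continuous_mult q continuous_intros)
    show "integrable M (\<lambda>x. S * \<bar>min 0 (q x)\<bar>)" using min_int by simp
    fix x assume "x \<in> space M"
    then have "(norm (f x))\<^sup>2 \<le> S" unfolding S_def by (intro x0) auto
    then have "(norm (f x))\<^sup>2 * \<bar>min 0 (q x)\<bar> \<le> S * \<bar>min 0 (q x)\<bar>" by (rule mult_right_mono) simp
    moreover have "- ((norm (f x))\<^sup>2 * q x) \<le> (norm (f x))\<^sup>2 * \<bar>min 0 (q x)\<bar>"
    proof -
      have "(norm (f x))\<^sup>2 * (- q x) \<le> (norm (f x))\<^sup>2 * \<bar>min 0 (q x)\<bar>"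
        by (intro mult_left_mono) auto
      then show ?thesis by simp
    qed
    ultimately show "- ((norm (f x))\<^sup>2 * q x) \<le> S * \<bar>min 0 (q x)\<bar>" by simp
  qed
  also have "\<dots> = S * L1_norm a b (\<lambda>x. min 0 (q x))" by (simp add: L1_norm_def)
  finally have "- Q \<le> S * L1_norm a b (\<lambda>x. min 0 (q x))" .
  moreover have "r \<le> c * S" using bdle[of S] x0(2)[of a] x0(2)[of b] ab by (simp add: S_def)
  ultimately have P: "energy \<le> \<alpha> * S" unfolding en \<alpha>(1) by (simp add: algebra_simps)
  define \<nu> \<pi> L where "\<nu> = sqrt mass" and "\<pi> = sqrt energy" and "L = 1 / (b - a)"
  have nn: "\<nu> \<ge> 0" "\<pi> \<ge> 0" "L > 0" "\<nu>\<^sup>2 = mass" "\<pi>\<^sup>2 = energy"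
    using nonneg ab by (auto simp: \<nu>_def \<pi>_def L_def)
  have S: "S \<le> L * \<nu>\<^sup>2 + 2 * (\<nu> * \<pi>)"
    using norm_sq_le[OF x0(1)] nonneg by (simp add: S_def \<nu>_def \<pi>_def L_def)
  have "\<pi>\<^sup>2 \<le> \<alpha> * (L * \<nu>\<^sup>2 + 2 * (\<nu> * \<pi>))"
    using P mult_left_mono[OF S \<alpha>(2)] nn by simp
  \<comment> \<open>Completing the square in \<pi>, rather than solving for the quotient of \<pi>
    and \<nu>, includes the case \<open>mass = 0\<close>.\<close>
  then have "(\<pi> - \<alpha> * \<nu>)\<^sup>2 \<le> (\<alpha> * (L + \<alpha>)) * \<nu>\<^sup>2"
    by (simp add: power2_eq_square algebra_simps)
  then have "\<pi> - \<alpha> * \<nu> \<le> sqrt ((\<alpha> * (L + \<alpha>)) * \<nu>\<^sup>2)" by (rule real_le_rsqrt)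
  also have "\<dots> = sqrt (\<alpha> * (L + \<alpha>)) * \<nu>"
    by (simp only: real_sqrt_mult real_sqrt_abs abs_of_nonneg[OF nn(1)])
  finally have \<pi>: "\<pi> \<le> \<beta> * \<nu>" by (simp add: \<beta> L_def algebra_simps)
  then show "sqrt energy \<le> \<beta> * sqrt mass" by (simp add: \<nu>_def \<pi>_def)
  fix x assume "x \<in> {a..b}"
  then have "(norm (f x))\<^sup>2 \<le> S" unfolding S_def by (rule x0)
  also have "\<dots> \<le> L * \<nu>\<^sup>2 + 2 * (\<nu> * (\<beta> * \<nu>))"
    using S mult_left_mono[OF \<pi> nn(1)] by simp
  also have "\<dots> = (2 * \<beta> + L) * \<nu>\<^sup>2" by (simp add: power2_eq_square algebra_simps)
  also have "2 * \<beta> + L = \<gamma>\<^sup>2"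
  proof -
    have "\<beta> \<ge> 0" unfolding \<beta> using \<alpha>(2) ab by (intro add_nonneg_nonneg real_sqrt_ge_zero mult_nonneg_nonneg) auto
    then have "2 * \<beta> + L \<ge> 0" using nn(3) by simp
    then show ?thesis by (simp add: \<gamma> L_def)
  qed
  finally show "(norm (f x))\<^sup>2 \<le> \<gamma>\<^sup>2 * mass" using nn by simp
qed

text \<open>The integrand dominates \<open>\<epsilon> * (\<bar>f\<bar>\<^sup>2 - S * (1 -
  \<bar>g\<bar>) - S * indicator E)\<close> pointwise: on \<open>E\<close> this minorant is not
  positive, and off \<open>E\<close> the weight is at least \<epsilon>. Each of the two subtracted
  terms integrates to at most \<open>S * \<eta>\<close>.\<close>

lemma cutoff_mass_lower_bound:
  fixes g :: "real \<Rightarrow> real"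
  assumes g: "ac_on a b g" and g1: "AE x in M. \<bar>g x\<bar> \<le> 1"
    and gw: "AE x in M. g x * w x = \<bar>g x\<bar> * \<bar>w x\<bar>"
    and gint: "(LINT x|M. 1 - \<bar>g x\<bar>) \<le> \<eta>"
    and \<epsilon>: "\<epsilon> > 0" and small: "measure lebesgue {x\<in>{a<..<b}. \<bar>w x\<bar> < \<epsilon>} \<le> \<eta>"
    and S: "\<And>x. x \<in> {a..b} \<Longrightarrow> (norm (f x))\<^sup>2 \<le> S" "S \<ge> 0"
  shows "\<epsilon> * (mass - 2 * (S * \<eta>)) \<le> (LINT x|M. (g x * (norm (f x))\<^sup>2) * w x)"
proof -
  define E where "E = {x\<in>{a<..<b}. \<bar>w x\<bar> < \<epsilon>}"
  have cg[continuous_intros]: "continuous_on {a..b} g" by (rule ac_on_imp_continuous_on[OF g])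
  have wm: "w \<in> borel_measurable M" using w by auto
  have "{x \<in> space M. \<bar>w x\<bar> < \<epsilon>} \<in> sets M" using wm by measurable
  then have EM: "E \<in> sets M" by (simp add: E_def)
  have [simp]: "E \<inter> {a<..<b} = E" by (auto simp: E_def)
  have mE: "measure M E = measure lebesgue E"
    by (rule measure_restrict_space) (auto simp: E_def)
  have Eint: "integrable M (indicator E :: real \<Rightarrow> real)"
    by (rule Bochner_Integration.integrable_bound[OF integrable_lebesgue_on_const[of _ _ "1::real"]])
      (use EM in \<open>auto simp: indicator_def\<close>)
  have gi: "integrable M (\<lambda>x. 1 - \<bar>g x\<bar>)"
    by (intro integrable_lebesgue_on_continuous continuous_intros)
  have LE: "(LINT x|M. indicator E x) = measure lebesgue E" using EM mE by simp
  have lin: "(LINT x|M. \<epsilon> * (A x - S * H x - S * K x)) =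
      \<epsilon> * ((LINT x|M. A x) - S * (LINT x|M. H x) - S * (LINT x|M. K x))"
    if "integrable M A" "integrable M H" "integrable M K" for A H K :: "real \<Rightarrow> real"
    using that by simp
  have "\<epsilon> * (mass - 2 * (S * \<eta>)) \<le> \<epsilon> * (mass - S * (LINT x|M. 1 - \<bar>g x\<bar>) - S * measure lebesgue E)"
  proof (intro mult_left_mono)
    have "S * (LINT x|M. 1 - \<bar>g x\<bar>) \<le> S * \<eta>" "S * measure lebesgue E \<le> S * \<eta>"
      using gint small S(2) unfolding E_def by (auto intro: mult_left_mono)
    then show "mass - 2 * (S * \<eta>) \<le> mass - S * (LINT x|M. 1 - \<bar>g x\<bar>) - S * measure lebesgue E"
      by simp
  qed (use \<epsilon> in simp)
  also have "\<epsilon> * (mass - S * (LINT x|M. 1 - \<bar>g x\<bar>) - S * measure lebesgue E)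
      = (LINT x|M. \<epsilon> * ((norm (f x))\<^sup>2 - S * (1 - \<bar>g x\<bar>) - S * indicator E x))"
    using lin[OF integrable_sqs(1) gi Eint] EM by (simp only: mass_def LE)
  also have "\<dots> \<le> (LINT x|M. (g x * (norm (f x))\<^sup>2) * w x)"
  proof (rule integral_mono_AE)
    show "integrable M (\<lambda>x. \<epsilon> * ((norm (f x))\<^sup>2 - S * (1 - \<bar>g x\<bar>) - S * indicator E x))"
      by (intro integrable_mult_right Bochner_Integration.integrable_diff integrable_sqs gi Eint)
    show "integrable M (\<lambda>x. (g x * (norm (f x))\<^sup>2) * w x)"
      by (intro integrable_continuous_mult w continuous_intros)
    have "AE x in M. x \<in> {a<..<b}" by (rule AE_I2) auto
    with g1 gw show "AE x in M. \<epsilon> * ((norm (f x))\<^sup>2 - S * (1 - \<bar>g x\<bar>) - S * indicator E x)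
        \<le> (g x * (norm (f x))\<^sup>2) * w x"
    proof eventually_elim
      fix x assume x: "\<bar>g x\<bar> \<le> 1" "g x * w x = \<bar>g x\<bar> * \<bar>w x\<bar>" "x \<in> {a<..<b}"
      define F where "F = (norm (f x))\<^sup>2"
      have F: "0 \<le> F" "F \<le> S" using S(1)[of x] x(3) by (auto simp: F_def)
      have "F * (1 - \<bar>g x\<bar>) \<le> S * (1 - \<bar>g x\<bar>)" using F x by (intro mult_right_mono) auto
      then have le: "F - S * (1 - \<bar>g x\<bar>) \<le> F * \<bar>g x\<bar>" by (simp add: algebra_simps)
      have "(g x * F) * w x = F * \<bar>g x\<bar> * \<bar>w x\<bar>" using x(2) by (simp add: mult.assoc mult.left_commute)
      moreover have "\<epsilon> * (F - S * (1 - \<bar>g x\<bar>) - S * indicator E x) \<le> F * \<bar>g x\<bar> * \<bar>w x\<bar>"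
      proof (cases "x \<in> E")
        case True
        have "F - S * (1 - \<bar>g x\<bar>) - S * indicator E x \<le> 0"
          using True F x S(2) by simp (smt (verit) mult_nonneg_nonneg)
        then have "\<epsilon> * (F - S * (1 - \<bar>g x\<bar>) - S * indicator E x) \<le> 0"
          using \<epsilon> by (simp add: mult_nonneg_nonpos)
        also have "0 \<le> F * \<bar>g x\<bar> * \<bar>w x\<bar>" using F by simp
        finally show ?thesis .
      next
        case False
        then have "\<epsilon> \<le> \<bar>w x\<bar>" using x by (auto simp: E_def)
        have "\<epsilon> * (F - S * (1 - \<bar>g x\<bar>) - S * indicator E x) \<le> \<epsilon> * (F * \<bar>g x\<bar>)"
          using False le \<epsilon> by simp
        also have "\<dots> \<le> \<bar>w x\<bar> * (F * \<bar>g x\<bar>)" using \<open>\<epsilon> \<le> \<bar>w x\<bar>\<close> F by (intro mult_right_mono) auto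
        finally show ?thesis by (simp add: mult.commute)
      qed
      ultimately show "\<epsilon> * ((norm (f x))\<^sup>2 - S * (1 - \<bar>g x\<bar>) - S * indicator E x)
        \<le> (g x * (norm (f x))\<^sup>2) * w x" unfolding F_def by linarith
    qed
  qed
  finally show ?thesis .
qed

text \<open>Testing with \<open>g * f\<close> gives \<open>z * X = E + (Q + P)\<close> with
  \<open>X\<close> positive and \<open>Q\<close>, \<open>P\<close> real. Only the ramp term
  \<open>E\<close> can have an imaginary part, which is why \<open>q\<close> and \<beta>^2 appear in
  the bound for \<open>Re z\<close> alone.\<close>

lemma eigenvalue_bounds:
  assumes bd: "p b * cnj (f b) - p a * cnj (f a) = of_real r"
    and bdle: "\<And>S. (norm (f a))\<^sup>2 \<le> S \<Longrightarrow> (norm (f b))\<^sup>2 \<le> S \<Longrightarrow> \<bar>r\<bar> \<le> c * S"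
    and \<alpha>: "\<alpha> = c + L1_norm a b (\<lambda>x. min 0 (q x))" "\<alpha> \<ge> 0"
    and \<beta>: "\<beta> = sqrt (\<alpha> * (1 / (b - a) + \<alpha>)) + \<alpha>"
    and \<gamma>: "\<gamma> = sqrt (2 * \<beta> + 1 / (b - a))"
    and z: "Im z \<noteq> 0"
    and w0: "AE x in M. w x \<noteq> 0" and tp: "has_turning_points a b w n"
    and \<epsilon>: "\<epsilon> > 0" "measure lebesgue {x\<in>{a<..<b}. \<bar>w x\<bar> < \<epsilon>} \<le> 1 / (4 * \<gamma>\<^sup>2)"
    and mass: "mass > 0"
  shows "\<bar>Im z\<bar> \<le> 8 / \<epsilon> * \<beta> * \<gamma>\<^sup>2 * (real n + 1) \<and>
         \<bar>Re z\<bar> \<le> 2 / \<epsilon> * (4 * \<beta> * \<gamma>\<^sup>2 * (real n + 1) + (\<beta>\<^sup>2 + \<gamma>\<^sup>2 * L1_norm a b q))"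
proof -
  note ap = a_priori[OF bd bdle \<alpha> \<beta> \<gamma> z]
  have \<beta>0: "\<beta> \<ge> 0" unfolding \<beta> using \<alpha>(2) ab
    by (intro add_nonneg_nonneg real_sqrt_ge_zero mult_nonneg_nonneg) auto
  have \<gamma>2: "\<gamma>\<^sup>2 = 2 * \<beta> + 1 / (b - a)" using \<beta>0 ab by (simp add: \<gamma>)
  have \<gamma>0: "\<gamma>\<^sup>2 > 0" unfolding \<gamma>2 using \<beta>0 ab by (intro add_nonneg_pos) auto
  \<comment> \<open>The ramp width for which \<open>(real n + 1) * d\<close> equals the measure
    \<open>1 / (4 * \<gamma>\<^sup>2)\<close> allowed for small |w|; both losses then fit the same
    \<open>\<eta>\<close>.\<close>
  define d where "d = 1 / (4 * \<gamma>\<^sup>2 * (real n + 1))"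
  have d: "d > 0" using \<gamma>0 by (simp add: d_def)
  obtain g where g: "ac_on a b g" "g a = 0" "g b = 0"
    "AE t in M. \<bar>g t\<bar> \<le> 1 \<and> g t * w t = \<bar>g t\<bar> * \<bar>w t\<bar> \<and>
       (\<forall>D. ((\<lambda>x. complex_of_real (g x)) has_vector_derivative D) (at t) \<longrightarrow> norm D \<le> 1 / d)"
    "(LINT t|M. 1 - \<bar>g t\<bar>) \<le> (real n + 1) * d"
    using turning_point_cutoff[OF ab tp w0 d] by blast
  have dn: "(real n + 1) * d = 1 / (4 * \<gamma>\<^sup>2)" by (simp add: d_def)
  have g1: "AE x in M. \<bar>g x\<bar> \<le> 1" using g(4) by (rule AE_mp) auto
  have gw: "AE x in M. g x * w x = \<bar>g x\<bar> * \<bar>w x\<bar>" using g(4) by (rule AE_mp) auto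
  have cg[continuous_intros]: "continuous_on {a..b} g" by (rule ac_on_imp_continuous_on[OF g(1)])
  obtain gd where gd: "integrable M gd"
    "AE x in M. ((\<lambda>x. complex_of_real (g x)) has_vector_derivative gd x) (at x)"
    using ac_on_fundamental[OF ab ac_on_bounded_linear[OF bounded_linear_of_real g(1)]] by metis
  define X where "X = (LINT x|M. (g x * (norm (f x))\<^sup>2) * w x)"
  define E where "E = (LINT x|M. (p x * cnj (f x)) * gd x)"
  define Q where "Q = (LINT x|M. (g x * (norm (f x))\<^sup>2) * q x)"
  define P where "P = (LINT x|M. g x * (norm (p x))\<^sup>2)"
  have main: "z * of_real X = E + of_real (Q + P)"
    using weak_form[OF g(1) gd] g(2,3) unfolding X_def E_def Q_def P_def
    by (simp add: algebra_simps)
  \<comment> \<open>With \<open>S = \<gamma>\<^sup>2 * mass\<close> each loss is a quarter of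
    \<open>mass\<close>, so half of it remains.\<close>
  have "\<epsilon> * (mass - 2 * ((\<gamma>\<^sup>2 * mass) * (1 / (4 * \<gamma>\<^sup>2)))) \<le> X"
    unfolding X_def
    by (rule cutoff_mass_lower_bound[OF g(1) g1 gw g(5)[unfolded dn] \<epsilon> ap(2)])
      (use mass in auto)
  moreover have "(\<gamma>\<^sup>2 * mass) * (1 / (4 * \<gamma>\<^sup>2)) = mass / 4"
    using \<gamma>0 by simp
  ultimately have X: "\<epsilon> / 2 * mass \<le> X" by (simp only:) (simp add: field_simps)
  then have X0: "X > 0" using \<epsilon> mass by (smt (verit) half_gt_zero mult_pos_pos)
  have E: "norm E \<le> 4 * \<beta> * \<gamma>\<^sup>2 * (real n + 1) * mass"
  proof -
    have "norm E \<le> (LINT x|M. norm ((p x * cnj (f x)) * gd x))"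
      unfolding E_def by (rule integral_norm_bound)
    also have "\<dots> \<le> (LINT x|M. (1 / d) * (norm (f x) * norm (p x)))"
    proof (rule integral_mono_AE)
      show "integrable M (\<lambda>x. norm ((p x * cnj (f x)) * gd x))"
        by (intro integrable_norm integrable_continuous_mult gd continuous_intros)
      show "integrable M (\<lambda>x. (1 / d) * (norm (f x) * norm (p x)))"
        by (intro integrable_mult_right integrable_sqs)
      show "AE x in M. norm ((p x * cnj (f x)) * gd x) \<le> (1 / d) * (norm (f x) * norm (p x))"
        using g(4) gd(2)
      proof eventually_elim
        fix x assume "\<bar>g x\<bar> \<le> 1 \<and> g x * w x = \<bar>g x\<bar> * \<bar>w x\<bar> \<and>
          (\<forall>D. ((\<lambda>x. complex_of_real (g x)) has_vector_derivative D) (at x) \<longrightarrow> norm D \<le> 1 / d)"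
          "((\<lambda>x. complex_of_real (g x)) has_vector_derivative gd x) (at x)"
        then have "norm (gd x) \<le> 1 / d" by blast
        then have "norm (gd x) * (norm (f x) * norm (p x)) \<le> (1 / d) * (norm (f x) * norm (p x))"
          by (rule mult_right_mono) simp
        then show "norm ((p x * cnj (f x)) * gd x) \<le> (1 / d) * (norm (f x) * norm (p x))"
          by (simp add: norm_mult mult_ac)
      qed
    qed
    also have "\<dots> = (1 / d) * cross" by (simp add: cross_def)
    \<comment> \<open>Cauchy-Schwarz together with the a priori bound gives
      \<open>cross \<le> \<beta> * mass\<close>.\<close>
    also have "\<dots> \<le> (1 / d) * (sqrt mass * (\<beta> * sqrt mass))"
      by (intro mult_left_mono order.trans[OF cross_le] ap(1)) (use mass d in auto)
    also have "\<dots> = (1 / d) * \<beta> * (sqrt mass * sqrt mass)" by (simp only: mult_ac)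
    also have "sqrt mass * sqrt mass = mass" using mass by simp
    also have "1 / d = 4 * \<gamma>\<^sup>2 * (real n + 1)" by (simp add: d_def)
    finally show ?thesis by (simp add: mult_ac)
  qed
  have Pb: "\<bar>P\<bar> \<le> \<beta>\<^sup>2 * mass"
  proof -
    have "\<bar>P\<bar> \<le> (LINT x|M. \<bar>g x * (norm (p x))\<^sup>2\<bar>)"
      unfolding P_def by (rule integral_abs_bound)
    also have "\<dots> \<le> energy"
      unfolding energy_def
    proof (rule integral_mono_AE[OF _ integrable_sqs(2)])
      show "integrable M (\<lambda>x. \<bar>g x * (norm (p x))\<^sup>2\<bar>)"
        by (intro integrable_lebesgue_on_continuous continuous_intros)
      show "AE x in M. \<bar>g x * (norm (p x))\<^sup>2\<bar> \<le> (norm (p x))\<^sup>2"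
        using g1 by eventually_elim (simp add: abs_mult mult_left_le_one_le)
    qed
    also have "energy = (sqrt energy)\<^sup>2" using nonneg by simp
    also have "\<dots> \<le> (\<beta> * sqrt mass)\<^sup>2" using ap(1) nonneg by (intro power_mono) auto
    also have "\<dots> = \<beta>\<^sup>2 * mass" using mass by (simp add: power_mult_distrib)
    finally show ?thesis .
  qed
  have Qb: "\<bar>Q\<bar> \<le> \<gamma>\<^sup>2 * L1_norm a b q * mass"
  proof -
    have "\<bar>Q\<bar> \<le> (LINT x|M. \<bar>(g x * (norm (f x))\<^sup>2) * q x\<bar>)"
      unfolding Q_def by (rule integral_abs_bound)
    also have "\<dots> \<le> (LINT x|M. (\<gamma>\<^sup>2 * mass) * \<bar>q x\<bar>)"
    proof (rule integral_mono_AE)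
      show "integrable M (\<lambda>x. \<bar>(g x * (norm (f x))\<^sup>2) * q x\<bar>)"
        by (intro integrable_abs integrable_continuous_mult q continuous_intros)
      show "integrable M (\<lambda>x. (\<gamma>\<^sup>2 * mass) * \<bar>q x\<bar>)" using q by simp
      have "AE x in M. x \<in> {a<..<b}" by (rule AE_I2) auto
      with g1 show "AE x in M. \<bar>(g x * (norm (f x))\<^sup>2) * q x\<bar> \<le> (\<gamma>\<^sup>2 * mass) * \<bar>q x\<bar>"
      proof eventually_elim
        fix x assume x: "\<bar>g x\<bar> \<le> 1" "x \<in> {a<..<b}"
        have "\<bar>g x\<bar> * (norm (f x))\<^sup>2 \<le> 1 * (\<gamma>\<^sup>2 * mass)"
          using x ap(2)[of x] by (intro mult_mono) auto
        then have "\<bar>g x\<bar> * (norm (f x))\<^sup>2 * \<bar>q x\<bar> \<le> 1 * (\<gamma>\<^sup>2 * mass) * \<bar>q x\<bar>"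
          by (rule mult_right_mono) simp
        then show "\<bar>(g x * (norm (f x))\<^sup>2) * q x\<bar> \<le> (\<gamma>\<^sup>2 * mass) * \<bar>q x\<bar>"
          by (simp add: abs_mult)
      qed
    qed
    also have "\<dots> = \<gamma>\<^sup>2 * L1_norm a b q * mass" by (simp add: L1_norm_def)
    finally show ?thesis .
  qed
  have divide: "y \<le> 2 / \<epsilon> * K" if "y * X \<le> K * mass" "y \<ge> 0" for y K
  proof -
    have "y * (\<epsilon> / 2 * mass) \<le> K * mass"
      using mult_left_mono[OF X that(2)] that(1) by linarith
    then have "(y * (\<epsilon> / 2)) * mass \<le> K * mass" by (simp add: mult_ac)
    then have "y * (\<epsilon> / 2) \<le> K" using mass by (simp only: mult_le_cancel_right_pos)
    then show ?thesis using \<epsilon> by (simp add: field_simps)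
  qed
  have "Im z * X = Im E" using arg_cong[OF main, of Im] by simp
  then have "\<bar>Im z\<bar> * X = \<bar>Im E\<bar>" using X0 by (metis abs_mult abs_of_pos)
  also have "\<dots> \<le> (4 * \<beta> * \<gamma>\<^sup>2 * (real n + 1)) * mass" using abs_Im_le_cmod[of E] E by simp
  finally have 1: "\<bar>Im z\<bar> \<le> 2 / \<epsilon> * (4 * \<beta> * \<gamma>\<^sup>2 * (real n + 1))" by (rule divide) simp
  have "Re z * X = Re E + (Q + P)" using arg_cong[OF main, of Re] by simp
  then have "\<bar>Re z\<bar> * X = \<bar>Re E + (Q + P)\<bar>" using X0 by (metis abs_mult abs_of_pos)
  also have "\<dots> \<le> (4 * \<beta> * \<gamma>\<^sup>2 * (real n + 1) + (\<beta>\<^sup>2 + \<gamma>\<^sup>2 * L1_norm a b q)) * mass"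
    using abs_Re_le_cmod[of E] E Pb Qb by (simp add: distrib_right)
  finally have 2: "\<bar>Re z\<bar> \<le> 2 / \<epsilon> * (4 * \<beta> * \<gamma>\<^sup>2 * (real n + 1) + (\<beta>\<^sup>2 + \<gamma>\<^sup>2 * L1_norm a b q))"
    by (rule divide) simp
  show ?thesis using 1 2 by simp
qed

end

section \<open>Boundary conditions\<close>

text \<open>The share of one endpoint in \<open>domain_constant\<close>, so that the four separated
  cases need no separate treatment.\<close>

fun endpoint_constant :: "endpoint_parameter \<Rightarrow> real" where
  "endpoint_constant (Finite l) = \<bar>l\<bar>"
| "endpoint_constant Infinite = 0"

lemma endpoint_form:
  assumes "endpoint_condition l y y'"
  shows "\<exists>r. y' * cnj y = of_real r \<and> \<bar>r\<bar> \<le> endpoint_constant l * (norm y)\<^sup>2"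
proof (cases l)
  case (Finite t)
  then have "y' * cnj y = of_real (t * (norm y)\<^sup>2)"
    using assms by (simp add: complex_norm_square mult.assoc del: of_real_power)
  moreover have "\<bar>t * (norm y)\<^sup>2\<bar> \<le> endpoint_constant l * (norm y)\<^sup>2"
    using Finite by (simp add: abs_mult)
  ultimately show ?thesis by blast
next
  case Infinite
  then show ?thesis using assms by (intro exI[of _ 0]) simp
qed

text \<open>For \<open>r12 \<noteq> 0\<close> the derivative at \<open>a\<close> can be eliminated,
  and the boundary form becomes a Hermitian form in the two boundary values divided by
  \<open>r12\<close>.\<close>

lemma coupled_form_nonzero:
  fixes u ya yb pa pb :: complex and r11 r12 r21 r22 :: real
  assumes u: "u * cnj u = 1" and det: "r11 * r22 - r12 * r21 = 1" and r12: "r12 \<noteq> 0"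
    and yb: "yb = u * (of_real r11 * ya + of_real r12 * pa)"
    and pb: "pb = u * (of_real r21 * ya + of_real r22 * pa)"
  shows "pb * cnj yb - pa * cnj ya =
    of_real ((r22 * (norm yb)\<^sup>2 + r11 * (norm ya)\<^sup>2 - 2 * Re (u * ya * cnj yb)) / r12)"
proof -
  have pa: "of_real r12 * pa = cnj u * yb - of_real r11 * ya"
  proof -
    have "cnj u * yb = (u * cnj u) * (of_real r11 * ya + of_real r12 * pa)"
      unfolding yb by (simp only: mult_ac)
    then show ?thesis using u by simp
  qed
  have det': "complex_of_real r11 * of_real r22 - of_real r12 * of_real r21 = 1"
    using arg_cong[OF det, of complex_of_real] by simp
  have n: "complex_of_real ((norm y)\<^sup>2) = y * cnj y" for y by (rule complex_norm_square)
  have re: "complex_of_real (2 * Re (u * ya * cnj yb)) = u * ya * cnj yb + cnj u * cnj ya * yb"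
    using complex_add_cnj[of "u * ya * cnj yb"] by simp
  have "of_real r12 * (pb * cnj yb - pa * cnj ya) =
      u * (of_real r12 * of_real r21 * ya + of_real r22 * (of_real r12 * pa)) * cnj yb
      - (of_real r12 * pa) * cnj ya"
    unfolding pb by (simp add: algebra_simps)
  \<comment> \<open>The determinant condition gives the first mixed term the coefficient -1, so the
    two mixed terms are complex conjugates and add up to a real number.\<close>
  also have "\<dots> = of_real r22 * (u * cnj u) * (yb * cnj yb)
      - (of_real r11 * of_real r22 - of_real r12 * of_real r21) * (u * ya * cnj yb)
      - cnj u * cnj ya * yb + of_real r11 * (ya * cnj ya)"
    unfolding pa by (simp add: algebra_simps)
  also have "\<dots> = of_real r22 * of_real ((norm yb)\<^sup>2) + of_real r11 * of_real ((norm ya)\<^sup>2)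
      - of_real (2 * Re (u * ya * cnj yb))"
    unfolding u det' n re by simp
  also have "\<dots> = of_real (r22 * (norm yb)\<^sup>2 + r11 * (norm ya)\<^sup>2 - 2 * Re (u * ya * cnj yb))"
    by simp
  finally show ?thesis using r12 by (simp add: field_simps)
qed

text \<open>Here \<open>r11 * r22 = 1\<close>, so the term with \<open>pa * cnj ya\<close> at
  \<open>b\<close> cancels the one at \<open>a\<close>, and the phase \<open>u\<close> drops
  out.\<close>

lemma coupled_form_zero:
  fixes u ya yb pa pb :: complex and r11 r21 r22 :: real
  assumes u: "u * cnj u = 1" and det: "r11 * r22 = 1"
    and yb: "yb = u * (of_real r11 * ya)"
    and pb: "pb = u * (of_real r21 * ya + of_real r22 * pa)"
  shows "pb * cnj yb - pa * cnj ya = of_real (r11 * r21 * (norm ya)\<^sup>2)"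
proof -
  have det': "complex_of_real r11 * of_real r22 = 1"
    using arg_cong[OF det, of complex_of_real] by simp
  have n: "complex_of_real ((norm ya)\<^sup>2) = ya * cnj ya" by (rule complex_norm_square)
  have "pb * cnj yb = (u * cnj u) * (of_real r11 * of_real r21 * (ya * cnj ya)
      + (of_real r11 * of_real r22) * (pa * cnj ya))"
    unfolding yb pb by (simp add: algebra_simps)
  then show ?thesis unfolding u det' of_real_mult n by simp
qed

lemma domain_constant_nonneg: "domain_constant B \<ge> 0"
  by (cases B rule: domain_constant.cases) auto

lemma selfadjoint_domain_boundary_form:
  assumes adm: "admissible_condition B" and f: "f \<in> selfadjoint_domain a b q w B"
  obtains r where
    "deriv_within a b f b * cnj (f b) - deriv_within a b f a * cnj (f a) = of_real r"
    "\<And>S. (norm (f a))\<^sup>2 \<le> S \<Longrightarrow> (norm (f b))\<^sup>2 \<le> S \<Longrightarrow> \<bar>r\<bar> \<le> domain_constant B * S"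
proof (cases B)
  case (Separated l r)
  have "endpoint_condition l (f a) (deriv_within a b f a)"
    "endpoint_condition r (f b) (deriv_within a b f b)"
    using f Separated by auto
  from this[THEN endpoint_form] obtain s t where
    s: "deriv_within a b f a * cnj (f a) = of_real s" "\<bar>s\<bar> \<le> endpoint_constant l * (norm (f a))\<^sup>2" and
    t: "deriv_within a b f b * cnj (f b) = of_real t" "\<bar>t\<bar> \<le> endpoint_constant r * (norm (f b))\<^sup>2"
    by blast
  have c: "domain_constant B = endpoint_constant l + endpoint_constant r"
    unfolding Separated by (cases l; cases r) auto
  have nn: "endpoint_constant k \<ge> 0" for k by (cases k) auto
  show thesis
  proof (rule that[of "t - s"])
    fix S assume S: "(norm (f a))\<^sup>2 \<le> S" "(norm (f b))\<^sup>2 \<le> S"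
    have "endpoint_constant l * (norm (f a))\<^sup>2 \<le> endpoint_constant l * S"
      "endpoint_constant r * (norm (f b))\<^sup>2 \<le> endpoint_constant r * S"
      using S nn by (auto intro: mult_left_mono)
    then show "\<bar>t - s\<bar> \<le> domain_constant B * S" using s(2) t(2) unfolding c distrib_right by linarith
  qed (simp add: s t)
next
  case (Coupled \<phi> R)
  define u where "u = exp (\<i> * complex_of_real \<phi>)"
  have nu: "norm u = 1" by (simp add: u_def)
  have u: "u * cnj u = 1" using complex_norm_square[of u] nu by simp
  have det: "R$1$1 * R$2$2 - R$1$2 * R$2$1 = 1" using adm Coupled by (simp add: det_2)
  have yb: "f b = u * (of_real (R$1$1) * f a + of_real (R$1$2) * deriv_within a b f a)"
    and pb: "deriv_within a b f b = u * (of_real (R$2$1) * f a + of_real (R$2$2) * deriv_within a b f a)"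
    using f Coupled by (auto simp: u_def)
  show thesis
  proof (cases "R$1$2 = 0")
    case False
    show thesis
    proof (rule that[OF coupled_form_nonzero[OF u det False yb pb]])
      fix S assume S: "(norm (f a))\<^sup>2 \<le> S" "(norm (f b))\<^sup>2 \<le> S"
      \<comment> \<open>The mixed term is at most \<open>S\<close> by the inequality of arithmetic
        and geometric means; its factor 2 is the 2 in \<open>domain_constant\<close>.\<close>
      have "\<bar>Re (u * f a * cnj (f b))\<bar> \<le> norm (f a) * norm (f b)"
        using abs_Re_le_cmod[of "u * f a * cnj (f b)"] nu by (simp add: norm_mult)
      also have "\<dots> \<le> ((norm (f a))\<^sup>2 + (norm (f b))\<^sup>2) / 2"
        using sum_squares_bound[of "norm (f a)" "norm (f b)"] by simp
      also have "\<dots> \<le> S" using S by simp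
      finally have re: "\<bar>Re (u * f a * cnj (f b))\<bar> \<le> S" .
      have "\<bar>R$2$2 * (norm (f b))\<^sup>2\<bar> \<le> \<bar>R$2$2\<bar> * S" "\<bar>R$1$1 * (norm (f a))\<^sup>2\<bar> \<le> \<bar>R$1$1\<bar> * S"
        using S by (auto simp: abs_mult intro: mult_left_mono)
      then have "\<bar>R$2$2 * (norm (f b))\<^sup>2 + R$1$1 * (norm (f a))\<^sup>2 - 2 * Re (u * f a * cnj (f b))\<bar>
          \<le> (\<bar>R$1$1\<bar> + \<bar>R$2$2\<bar> + 2) * S"
        using re unfolding distrib_right by linarith
      then have "\<bar>R$2$2 * (norm (f b))\<^sup>2 + R$1$1 * (norm (f a))\<^sup>2 - 2 * Re (u * f a * cnj (f b))\<bar> / \<bar>R$1$2\<bar>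
          \<le> (\<bar>R$1$1\<bar> + \<bar>R$2$2\<bar> + 2) * S / \<bar>R$1$2\<bar>"
        by (rule divide_right_mono) simp
      then show "\<bar>(R$2$2 * (norm (f b))\<^sup>2 + R$1$1 * (norm (f a))\<^sup>2 - 2 * Re (u * f a * cnj (f b))) / R$1$2\<bar>
          \<le> domain_constant B * S"
        using Coupled False by (simp add: abs_divide)
    qed
  next
    case True
    have det0: "R$1$1 * R$2$2 = 1" using det True by simp
    have yb0: "f b = u * (of_real (R$1$1) * f a)" using yb True by simp
    show thesis
    proof (rule that[OF coupled_form_zero[OF u det0 yb0 pb]])
      fix S assume S: "(norm (f a))\<^sup>2 \<le> S"
      have "\<bar>R$1$1 * R$2$1 * (norm (f a))\<^sup>2\<bar> = \<bar>R$1$1 * R$2$1\<bar> * (norm (f a))\<^sup>2"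
        by (simp add: abs_mult)
      also have "\<dots> \<le> \<bar>R$1$1 * R$2$1\<bar> * S" using S by (intro mult_left_mono) auto
      finally show "\<bar>R$1$1 * R$2$1 * (norm (f a))\<^sup>2\<bar> \<le> domain_constant B * S"
        using Coupled True by simp
    qed
  qed
qed

section \<open>From the operator to the differential equation\<close>

lemma AE_weighted_measure_iff:
  assumes w: "integrable (lebesgue_on {a<..<b}) w"
    and w0: "AE x in lebesgue_on {a<..<b}. w x \<noteq> 0"
  shows "(AE x in weighted_measure a b w. P x) \<longleftrightarrow> (AE x in lebesgue_on {a<..<b}. P x)"
proof -
  have m: "(\<lambda>x. ennreal \<bar>w x\<bar>) \<in> borel_measurable (lebesgue_on {a<..<b})"
    using borel_measurable_integrable[OF w] by measurable
  have "(AE x in weighted_measure a b w. P x) \<longleftrightarrow>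
      (AE x in lebesgue_on {a<..<b}. ennreal \<bar>w x\<bar> > 0 \<longrightarrow> P x)"
    unfolding weighted_measure_def by (rule AE_density[OF m])
  also have "\<dots> \<longleftrightarrow> (AE x in lebesgue_on {a<..<b}. P x)"
  proof
    assume "AE x in lebesgue_on {a<..<b}. ennreal \<bar>w x\<bar> > 0 \<longrightarrow> P x"
    with w0 show "AE x in lebesgue_on {a<..<b}. P x" by eventually_elim simp
  next
    assume "AE x in lebesgue_on {a<..<b}. P x"
    then show "AE x in lebesgue_on {a<..<b}. ennreal \<bar>w x\<bar> > 0 \<longrightarrow> P x" by eventually_elim simp
  qed
  finally show ?thesis .
qed

text \<open>The second derivative in \<open>tau\<close> is an unspecified value where it does not
  exist. Absolute continuity of \<open>deriv_within a b f\<close> makes it a genuine two-sided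
  derivative almost everywhere, and there the eigenvalue equation can be solved for it.\<close>

lemma eigenfunction_ode:
  assumes ab: "a < b" and q: "integrable (lebesgue_on {a<..<b}) q"
    and w: "integrable (lebesgue_on {a<..<b}) w"
    and w0: "AE x in lebesgue_on {a<..<b}. w x \<noteq> 0"
    and f: "f \<in> maximal_domain a b q w"
    and eq: "AE x in weighted_measure a b w. tau a b q w f x = z * f x"
  shows "eigenfunction a b q w z f (deriv_within a b f)"
proof
  define p where "p = deriv_within a b f"
  show "a < b" "integrable (lebesgue_on {a<..<b}) q" "integrable (lebesgue_on {a<..<b}) w"
    by fact+
  show "(f has_vector_derivative deriv_within a b f x) (at x within {a..b})" if "x \<in> {a..b}" for x
    using f that unfolding maximal_domain_def deriv_within_def
    by (simp add: vector_derivative_works[symmetric])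
  show "ac_on a b f" and acp: "ac_on a b (deriv_within a b f)"
    using f by (auto simp: maximal_domain_def intro: ac_on_absolutely_continuous_on_interval)
  obtain k where k: "AE x in lebesgue_on {a<..<b}. (p has_vector_derivative k x) (at x)"
    using ac_on_fundamental[OF ab acp] unfolding p_def by metis
  have "AE x in lebesgue_on {a<..<b}. tau a b q w f x = z * f x"
    using eq AE_weighted_measure_iff[OF w w0] by blast
  moreover have "AE x in lebesgue_on {a<..<b}. x \<in> {a<..<b}" by (rule AE_I2) auto
  ultimately have "AE x in lebesgue_on {a<..<b}.
       (p has_vector_derivative (of_real (q x) - z * of_real (w x)) * f x) (at x)"
    using k w0
  proof eventually_elim
    fix x assume x: "tau a b q w f x = z * f x" "x \<in> {a<..<b}" "w x \<noteq> 0"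
      and kx: "(p has_vector_derivative k x) (at x)"
    have "deriv_within a b p x = k x"
      unfolding deriv_within_def
    proof (rule vector_derivative_within_cbox[of a b, unfolded box_real])
      show "(p has_vector_derivative k x) (at x within {a..b})"
        using kx by (rule has_vector_derivative_at_within)
    qed (use ab x in auto)
    then have "(- k x + of_real (q x) * f x) / of_real (w x) = z * f x"
      using x(1) by (simp add: tau_def p_def)
    then have "- k x + of_real (q x) * f x = z * f x * of_real (w x)"
      using x(3) by (simp add: field_simps)
    then have "k x = (of_real (q x) - z * of_real (w x)) * f x" by (simp add: algebra_simps)
    then show "(p has_vector_derivative (of_real (q x) - z * of_real (w x)) * f x) (at x)"
      using kx by simp
  qed
  then show "AE x in lebesgue_on {a<..<b}.
       (deriv_within a b f has_vector_derivative (of_real (q x) - z * of_real (w x)) * f x) (at x)"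
    by (simp only: p_def)
qed

theorem corollary3p3:
  fixes a b \<alpha> \<beta> \<gamma> \<epsilon> :: real
    and q w :: "real \<Rightarrow> real"
    and n :: nat
    and B :: boundary_condition
    and D :: "(real \<Rightarrow> complex) set"
    and z :: complex
  assumes "a < b"
    and "integrable (lebesgue_on {a<..<b}) q"
    and "integrable (lebesgue_on {a<..<b}) w"
    and "AE x in lebesgue_on {a<..<b}. w x \<noteq> 0"
    and "emeasure lebesgue {x\<in>{a<..<b}. w x > 0} > 0"
    and "emeasure lebesgue {x\<in>{a<..<b}. w x < 0} > 0"
    and "has_turning_points a b w n"
    and "admissible_condition B"
    and "D = selfadjoint_domain a b q w B"
    and "\<alpha> = domain_constant B + L1_norm a b (\<lambda>x. min 0 (q x))"
    and "\<beta> = sqrt (\<alpha> * (1 / (b - a) + \<alpha>)) + \<alpha>"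
    and "\<gamma> = sqrt (2 * \<beta> + 1 / (b - a))"
    and "\<epsilon> > 0"
    and "measure lebesgue {x\<in>{a<..<b}. \<bar>w x\<bar> < \<epsilon>} \<le> 1 / (4 * \<gamma>\<^sup>2)"
    and "is_eigenvalue a b q w D z"
    and "z \<notin> \<real>"
  shows "\<bar>Im z\<bar> \<le> 8 / \<epsilon> * \<beta> * \<gamma>\<^sup>2 * (real n + 1) \<and>
         \<bar>Re z\<bar> \<le> 2 / \<epsilon> * (4 * \<beta> * \<gamma>\<^sup>2 * (real n + 1) + (\<beta>\<^sup>2 + \<gamma>\<^sup>2 * L1_norm a b q))"
proof -
  obtain f where f: "f \<in> selfadjoint_domain a b q w B"
    and f0: "\<not> (AE x in weighted_measure a b w. f x = 0)"
    and feq: "AE x in weighted_measure a b w. tau a b q w f x = z * f x"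
    using assms(15) unfolding is_eigenvalue_def assms(9) by blast
  have "f \<in> maximal_domain a b q w" using f by (cases B) auto
  then interpret eigenfunction a b q w z f "deriv_within a b f"
    using assms(1-4) feq by (intro eigenfunction_ode)
  obtain r where r: "deriv_within a b f b * cnj (f b) - deriv_within a b f a * cnj (f a) = of_real r"
    "\<And>S. (norm (f a))\<^sup>2 \<le> S \<Longrightarrow> (norm (f b))\<^sup>2 \<le> S \<Longrightarrow> \<bar>r\<bar> \<le> domain_constant B * S"
    using selfadjoint_domain_boundary_form[OF assms(8) f] by blast
  have "L1_norm a b (\<lambda>x. min 0 (q x)) \<ge> 0"
    unfolding L1_norm_def by (rule Bochner_Integration.integral_nonneg) simp
  then have \<alpha>: "\<alpha> \<ge> 0" using domain_constant_nonneg[of B] assms(10) by simp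
  \<comment> \<open>\<open>mass\<close> is an unweighted integral while nontriviality refers to the
    weighted measure; the two agree because these measures have the same null sets.\<close>
  have "mass \<noteq> 0"
  proof
    assume "mass = 0"
    then have "AE x in lebesgue_on {a<..<b}. (norm (f x))\<^sup>2 = 0"
      unfolding mass_def using integrable_sqs(1) by (subst (asm) integral_nonneg_eq_0_iff_AE) auto
    then have "AE x in weighted_measure a b w. f x = 0"
      using AE_weighted_measure_iff[OF assms(3,4)] by simp
    with f0 show False by blast
  qed
  then have mass: "mass > 0" using nonneg(1) by simp
  have "Im z \<noteq> 0" using assms(16) by (simp add: complex_is_Real_iff)
  from eigenvalue_bounds[OF r assms(10) \<alpha> assms(11,12) this assms(4,7,13,14) mass]
  show ?thesis .
qed

end
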